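(* Let $N$ be a supernatural number, $n\in\mathbb Z$, and let $\delta:\mathcal B(N)\to B(N)$ be an $n$-covariant derivation in $B(N)$. Then there exists a (possibly unbounded) diagonal operator $\eta_n(\mathbb L)$ such that $$\delta(a)=[V^n\eta_n(\mathbb L),a]\qquad(\ast)$$ for every $a\in\mathcal B(N)$. If $N$ is infinite and $n\ne0$, or $N$ is finite and $N\nmid n$, then $\eta_n(\mathbb L)\in B_{\mathrm{diag}}(N)$; otherwise $\eta_n(\mathbb L+I)-\eta_n(\mathbb L)\in B_{\mathrm{diag}}(N)$. Conversely, given any $\eta_n(\mathbb L)$ satisfying these properties, formula $(\ast)$ defines an $n$-covariant derivation in $B(N)$.
   Context: A supernatural number is a formal product $N=\prod_{p\text{ prime}}p^{\epsilon_p}$ with $\epsilon_p\in\{0,1,\dots,\infty\}$; it is finite (an ordinary positive integer) if $\sum_p\epsilon_p<\infty$, and infinite otherwise. A positive integer $j$ divides $N$ ($j\mid N$) if for each prime $p$ the exponent of $p$ in $j$ is at most $\epsilon_p$. On $\ell^2(\mathbb Z)$ with canonical basis $\{E_l\}_{l\in\mathbb Z}$ let $VE_l=E_{l+1}$ be the bilateral shift, $\mathbb LE_l=lE_l$, and for a sequence $b(l)$ let $b(\mathbb L)E_l=b(l)E_l$ (a diagonal operator). Let $\mathcal B_{\mathrm{diag}}(N)=\{b(\mathbb L): b(l+j)=b(l)\ \forall l,\text{ for some positive integer } j\mid N\}$ and let $B_{\mathrm{diag}}(N)$ be its norm closure. The Bunce-Deddens algebra is (up to isomorphism) $B(N)=\mathrm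 C^*(V,\mathcal B_{\mathrm{diag}}(N))$; $\mathcal B(N)$ is the $^*$-subalgebra generated algebraically by $V,V^{-1}$ and $\mathcal B_{\mathrm{diag}}(N)$. A derivation in $B(N)$ is a linear map $\delta:\mathcal B(N)\to B(N)$ with $\delta(ab)=\delta(a)b+a\,\delta(b)$. Let $\rho_\theta(b)=e^{i\theta\mathbb L}be^{-i\theta\mathbb L}$, an automorphism of $B(N)$ preserving $\mathcal B(N)$. $\delta$ is $n$-covariant if $\rho_\theta^{-1}(\delta(\rho_\theta(b)))=e^{-in\theta}\delta(b)$ for all $\theta\in[0,2\pi)$, $b\in\mathcal B(N)$. Commutators with unbounded diagonal operators are computed on the linear span of $\{E_l\}$ (which $\mathcal B(N)$ preserves) and then extended to bounded operators. *)

theory Defs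
  imports "HOL-Analysis.Analysis" "HOL-Computational_Algebra.Primes"
begin

section \<open>Supernatural numbers\<close>

text \<open>The exponent of the prime \<open>p\<close> is \<open>N p\<close>; values of \<open>N\<close> at non-primes are never consulted.\<close>

type_synonym supernatural = "nat \<Rightarrow> enat"

definition sn_finite :: "supernatural \<Rightarrow> bool" where
  "sn_finite N \<longleftrightarrow> (\<Sum>\<^sub>\<infinity>p\<in>{p. prime p}. N p) < \<infinity>"

text \<open>The ordinary positive integer represented by a finite supernatural number
  (the index set is then finite and all exponents are finite).\<close>

definition sn_value :: "supernatural \<Rightarrow> nat" where
  "sn_value N = (\<Prod>p | prime p \<and> N p \<noteq> 0. p ^ the_enat (N p))"

definition sn_dvd :: "nat \<Rightarrow> supernatural \<Rightarrow> bool" where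
  "sn_dvd j N \<longleftrightarrow> j > 0 \<and> (\<forall>p. prime p \<longrightarrow> enat (multiplicity p j) \<le> N p)"

section \<open>The Hilbert space of square-summable bilateral sequences\<close>

definition square_summable :: "(int \<Rightarrow> complex) \<Rightarrow> bool" where
  "square_summable x \<longleftrightarrow> (\<lambda>k. (cmod (x k))\<^sup>2) summable_on UNIV"

lemma square_summable_0 [simp]: "square_summable (\<lambda>_. 0)"
  by (simp add: square_summable_def)

lemma square_summable_bound:
  assumes "square_summable x" "\<And>k. cmod (y k) \<le> C * cmod (x k)"
  shows "square_summable y"
  unfolding square_summable_def
proof (rule summable_on_comparison_test)
  show "(\<lambda>k. C\<^sup>2 * (cmod (x k))\<^sup>2) summable_on UNIV"
    using assms(1) unfolding square_summable_def by (rule summable_on_cmult_right)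
  show "(cmod (y k))\<^sup>2 \<le> C\<^sup>2 * (cmod (x k))\<^sup>2" for k
    using power_mono[OF assms(2)[of k], of 2] by (simp add: power_mult_distrib)
qed simp

lemma square_summable_cmult:
  assumes "square_summable x"
  shows "square_summable (\<lambda>k. c * x k)"
  by (rule square_summable_bound[OF assms, of _ "cmod c"]) (simp add: norm_mult)

lemma square_summable_add:
  assumes "square_summable x" "square_summable y"
  shows "square_summable (\<lambda>k. x k + y k)"
  unfolding square_summable_def
proof (rule summable_on_comparison_test)
  show "(\<lambda>k. 2 * (cmod (x k))\<^sup>2 + 2 * (cmod (y k))\<^sup>2) summable_on UNIV"
    using assms unfolding square_summable_def
    by (intro summable_on_add summable_on_cmult_right)
  show "(cmod (x k + y k))\<^sup>2 \<le> 2 * (cmod (x k))\<^sup>2 + 2 * (cmod (y k))\<^sup>2" for k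
  proof -
    have "(cmod (x k + y k))\<^sup>2 \<le> (cmod (x k) + cmod (y k))\<^sup>2"
      by (intro power_mono norm_triangle_ineq) simp
    also have "\<dots> \<le> 2 * (cmod (x k))\<^sup>2 + 2 * (cmod (y k))\<^sup>2"
      using sum_squares_bound[of "cmod (x k)" "cmod (y k)"]
      by (simp add: power2_sum)
    finally show ?thesis .
  qed
qed simp

lemma square_summable_shift:
  assumes "square_summable x"
  shows "square_summable (\<lambda>k. x (k - n))"
proof -
  have "bij_betw (\<lambda>k::int. k - n) UNIV UNIV"
    by (rule bij_betw_byWitness[of _ "\<lambda>k. k + n"]) auto
  from summable_on_reindex_bij_betw[OF this, of "\<lambda>k. (cmod (x k))\<^sup>2"]
  show ?thesis using assms by (simp add: square_summable_def)
qed

lemma square_summable_mult_cnj: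
  assumes "square_summable x" "square_summable y"
  shows "(\<lambda>k. x k * cnj (y k)) summable_on UNIV"
proof (rule abs_summable_summable, rule summable_on_comparison_test)
  show "(\<lambda>k. (cmod (x k))\<^sup>2 + (cmod (y k))\<^sup>2) summable_on UNIV"
    using assms unfolding square_summable_def by (intro summable_on_add)
  show "norm (x k * cnj (y k)) \<le> (cmod (x k))\<^sup>2 + (cmod (y k))\<^sup>2" for k
  proof -
    have "0 \<le> cmod (x k) * cmod (y k)" by simp
    then have "cmod (x k) * cmod (y k) \<le> 2 * cmod (x k) * cmod (y k)" by linarith
    also have "\<dots> \<le> (cmod (x k))\<^sup>2 + (cmod (y k))\<^sup>2" by (rule sum_squares_bound)
    finally show ?thesis by (simp add: norm_mult)
  qed
qed simp

typedef ell2 = "{x :: int \<Rightarrow> complex. square_summable x}"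
  morphisms coord Abs_ell2
  by (rule exI[of _ "\<lambda>_. 0"]) simp

setup_lifting type_definition_ell2

lemma square_summable_coord [simp]: "square_summable (coord x)"
  using coord by simp

lemma ell2_eqI: "(\<And>k. coord x k = coord y k) \<Longrightarrow> x = y"
  by (simp add: coord_inject[symmetric] ext)

lift_definition cscale :: "complex \<Rightarrow> ell2 \<Rightarrow> ell2" (infixr \<open>*\<^sub>c\<close> 75)
  is "\<lambda>c x k. c * x k" by (rule square_summable_cmult)

definition cinner :: "ell2 \<Rightarrow> ell2 \<Rightarrow> complex" where
  "cinner x y = (\<Sum>\<^sub>\<infinity>k. coord x k * cnj (coord y k))"

instantiation ell2 :: real_vector
begin

lift_definition zero_ell2 :: ell2 is "\<lambda>_. 0" by simp
lift_definition plus_ell2 :: "ell2 \<Rightarrow> ell2 \<Rightarrow> ell2" is "\<lambda>x y k. x k + y k"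
  by (rule square_summable_add)
lift_definition uminus_ell2 :: "ell2 \<Rightarrow> ell2" is "\<lambda>x k. - x k"
  by (simp add: square_summable_def)
definition minus_ell2 :: "ell2 \<Rightarrow> ell2 \<Rightarrow> ell2" where "minus_ell2 x y = x + - y"
definition scaleR_ell2 :: "real \<Rightarrow> ell2 \<Rightarrow> ell2" where
  "scaleR_ell2 r x = complex_of_real r *\<^sub>c x"

instance
  by standard
    (rule ell2_eqI; simp add: minus_ell2_def scaleR_ell2_def plus_ell2.rep_eq zero_ell2.rep_eq
      uminus_ell2.rep_eq cscale.rep_eq algebra_simps)+

end

lemma coord_zero [simp]: "coord 0 k = 0"
  by (simp add: zero_ell2.rep_eq)

lemma coord_add [simp]: "coord (x + y) k = coord x k + coord y k"
  by (simp add: plus_ell2.rep_eq)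

lemma coord_uminus [simp]: "coord (- x) k = - coord x k"
  by (simp add: uminus_ell2.rep_eq)

lemma coord_diff [simp]: "coord (x - y) k = coord x k - coord y k"
  unfolding minus_ell2_def coord_add coord_uminus by simp

lemma coord_cscale [simp]: "coord (c *\<^sub>c x) k = c * coord x k"
  by (simp add: cscale.rep_eq)

lemma coord_scaleR [simp]: "coord (r *\<^sub>R x) k = complex_of_real r * coord x k"
  by (simp add: scaleR_ell2_def)

lemma coord_sum: "coord (sum f F) k = (\<Sum>i\<in>F. coord (f i) k)"
  by (induction F rule: infinite_finite_induct) auto

lemma summable_mult_cnj [simp]: "(\<lambda>k. coord x k * cnj (coord y k)) summable_on UNIV"
  by (rule square_summable_mult_cnj[OF square_summable_coord square_summable_coord])

lemma cinner_commute: "cinner y x = cnj (cinner x y)"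
proof -
  have "cnj (cinner x y) = (\<Sum>\<^sub>\<infinity>k. cnj (coord x k * cnj (coord y k)))"
    unfolding cinner_def by (rule infsum_cnj[symmetric])
  then show ?thesis by (simp add: cinner_def mult.commute)
qed

lemma cinner_add_left: "cinner (x + y) z = cinner x z + cinner y z"
  unfolding cinner_def by (simp add: distrib_right infsum_add)

lemma cinner_cscale_left: "cinner (c *\<^sub>c x) y = c * cinner x y"
  unfolding cinner_def by (simp add: mult.assoc infsum_cmult_right')

lemma cinner_self: "cinner x x = complex_of_real (\<Sum>\<^sub>\<infinity>k. (cmod (coord x k))\<^sup>2)"
proof -
  have "cinner x x = (\<Sum>\<^sub>\<infinity>k. complex_of_real ((cmod (coord x k))\<^sup>2))"
    unfolding cinner_def by (simp only: complex_norm_square)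
  also have "\<dots> = complex_of_real (\<Sum>\<^sub>\<infinity>k. (cmod (coord x k))\<^sup>2)"
    by (rule infsumI, rule has_sum_of_real_iff[THEN iffD2], rule has_sum_infsum)
      (use square_summable_coord[of x] in \<open>simp only: square_summable_def\<close>)
  finally show ?thesis .
qed

instantiation ell2 :: real_inner
begin

definition inner_ell2 :: "ell2 \<Rightarrow> ell2 \<Rightarrow> real" where "inner_ell2 x y = Re (cinner x y)"
definition norm_ell2 :: "ell2 \<Rightarrow> real" where "norm_ell2 x = sqrt (inner x x)"
definition sgn_ell2 :: "ell2 \<Rightarrow> ell2" where "sgn_ell2 x = x /\<^sub>R norm x"
definition dist_ell2 :: "ell2 \<Rightarrow> ell2 \<Rightarrow> real" where "dist_ell2 x y = norm (x - y)"
definition uniformity_ell2 :: "(ell2 \<times> ell2) filter" where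
  "uniformity_ell2 = (INF e\<in>{0<..}. principal {(x, y). dist x y < e})"
definition open_ell2 :: "ell2 set \<Rightarrow> bool" where
  "open_ell2 U \<longleftrightarrow> (\<forall>x\<in>U. \<forall>\<^sub>F (x', y) in uniformity. x' = x \<longrightarrow> y \<in> U)"

instance
proof
  fix x y z :: ell2 and r :: real
  show "sgn x = x /\<^sub>R norm x" by (rule sgn_ell2_def)
  show "dist x y = norm (x - y)" by (rule dist_ell2_def)
  show "uniformity = (INF e\<in>{0<..}. principal {(x, y :: ell2). dist x y < e})"
    by (rule uniformity_ell2_def)
  show "inner x y = inner y x"
    unfolding inner_ell2_def by (subst cinner_commute) simp
  show "inner (x + y) z = inner x z + inner y z"
    by (simp add: inner_ell2_def cinner_add_left)
  show "inner (r *\<^sub>R x) y = r * inner x y"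
    by (simp add: inner_ell2_def scaleR_ell2_def cinner_cscale_left)
  show "0 \<le> inner x x"
    by (simp add: inner_ell2_def cinner_self infsum_nonneg)
  show "inner x x = 0 \<longleftrightarrow> x = 0"
  proof
    assume "inner x x = 0"
    then have "(\<Sum>\<^sub>\<infinity>k. (cmod (coord x k))\<^sup>2) = 0" by (simp add: inner_ell2_def cinner_self)
    then have "(cmod (coord x k))\<^sup>2 = 0" for k
      using square_summable_coord[of x] unfolding square_summable_def
      by (intro nonneg_infsum_le_0D[where f = "\<lambda>k. (cmod (coord x k))\<^sup>2" and A = UNIV]) auto
    then show "x = 0" by (intro ell2_eqI) simp
  qed (simp add: inner_ell2_def cinner_def)
  show "norm x = sqrt (inner x x)" by (rule norm_ell2_def)
  show "open U \<longleftrightarrow> (\<forall>x\<in>U. \<forall>\<^sub>F (x', y) in uniformity. x' = x \<longrightarrow> y \<in> U)" for U :: "ell2 set"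
    by (rule open_ell2_def)
qed

end

lemma norm_ell2_eq: "norm x = sqrt (\<Sum>\<^sub>\<infinity>k. (cmod (coord x k))\<^sup>2)"
  by (simp add: norm_ell2_def inner_ell2_def cinner_self)

lemma norm_ell2_le:
  assumes "\<And>k. cmod (coord y k) \<le> C * cmod (coord x k)" "C \<ge> 0"
  shows "norm y \<le> C * norm x"
proof -
  have "(\<Sum>\<^sub>\<infinity>k. (cmod (coord y k))\<^sup>2) \<le> (\<Sum>\<^sub>\<infinity>k. C\<^sup>2 * (cmod (coord x k))\<^sup>2)"
  proof (rule infsum_mono)
    show "(\<lambda>k. (cmod (coord y k))\<^sup>2) summable_on UNIV"
      using square_summable_coord[of y] by (simp add: square_summable_def)
    show "(\<lambda>k. C\<^sup>2 * (cmod (coord x k))\<^sup>2) summable_on UNIV"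
      using square_summable_coord[of x] unfolding square_summable_def
      by (rule summable_on_cmult_right)
    show "(cmod (coord y k))\<^sup>2 \<le> C\<^sup>2 * (cmod (coord x k))\<^sup>2" for k
      using power_mono[OF assms(1)[of k], of 2] by (simp add: power_mult_distrib)
  qed
  then have "sqrt (\<Sum>\<^sub>\<infinity>k. (cmod (coord y k))\<^sup>2) \<le> sqrt (C\<^sup>2 * (\<Sum>\<^sub>\<infinity>k. (cmod (coord x k))\<^sup>2))"
    by (simp add: infsum_cmult_right')
  then show ?thesis
    using assms(2) by (simp add: norm_ell2_eq real_sqrt_mult)
qed

lift_definition basis_vec :: "int \<Rightarrow> ell2" is "\<lambda>l k. if k = l then 1 else 0"
proof -
  fix l :: int
  show "square_summable (\<lambda>k. if k = l then 1 else 0)"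
    unfolding square_summable_def
    by (rule summable_on_cong_neutral[THEN iffD1, OF _ _ _ summable_on_finite[of "{l}"]]) auto
qed

lemma coord_basis_vec: "coord (basis_vec l) k = (if k = l then 1 else 0)"
  by (simp add: basis_vec.rep_eq)

text \<open>The (complex) linear span of the canonical basis, which is the common domain of the
  unbounded operators below.\<close>

definition finite_vecs :: "ell2 set" where
  "finite_vecs = {\<Sum>l\<in>F. c l *\<^sub>c basis_vec l | F c. finite F}"

lemma finite_vecs_iff: "x \<in> finite_vecs \<longleftrightarrow> finite {l. coord x l \<noteq> 0}"
proof
  assume "x \<in> finite_vecs"
  then obtain F c where F: "finite F" "x = (\<Sum>l\<in>F. c l *\<^sub>c basis_vec l)"
    by (auto simp: finite_vecs_def)
  have "coord x l = 0" if "l \<notin> F" for l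
    unfolding F(2) coord_sum by (rule sum.neutral) (use that in \<open>auto simp: coord_basis_vec\<close>)
  then have "{l. coord x l \<noteq> 0} \<subseteq> F" by auto
  then show "finite {l. coord x l \<noteq> 0}" using F(1) by (rule finite_subset)
next
  assume fin: "finite {l. coord x l \<noteq> 0}"
  have "x = (\<Sum>l\<in>{l. coord x l \<noteq> 0}. coord x l *\<^sub>c basis_vec l)"
    using fin by (intro ell2_eqI) (simp add: coord_sum coord_basis_vec if_distrib cong: if_cong)
  then show "x \<in> finite_vecs" using fin unfolding finite_vecs_def by blast
qed

section \<open>Operators\<close>

text \<open>Elements of this type are only real-linear; all sets of operators considered below lie in
  \<open>bounded_ops\<close>, the bounded complex-linear operators. Norm and topology are those of
  the library, i.e. the operator norm.\<close>

type_synonym ell2_op = "ell2 \<Rightarrow>\<^sub>L ell2"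

definition bounded_ops :: "ell2_op set" where
  "bounded_ops = {A :: ell2_op. \<forall>c x. A (c *\<^sub>c x) = c *\<^sub>c A x}"

definition is_adjoint :: "ell2_op \<Rightarrow> ell2_op \<Rightarrow> bool" where
  "is_adjoint A B \<longleftrightarrow> (\<forall>x y. cinner (A x) y = cinner x (B y))"

definition cscale_op :: "complex \<Rightarrow> ell2_op \<Rightarrow> ell2_op" where
  "cscale_op c A = Blinfun (\<lambda>x. c *\<^sub>c A x)"

lemma bounded_linear_cscale: "bounded_linear (cscale c)"
proof (rule bounded_linear_intro[where K = "cmod c"])
  show "norm (c *\<^sub>c x) \<le> norm x * cmod c" for x
    using norm_ell2_le[of "c *\<^sub>c x" "cmod c" x] by (simp add: norm_mult mult.commute)
qed (auto intro!: ell2_eqI simp: algebra_simps)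

lemma cscale_op_apply [simp]: "cscale_op c A x = c *\<^sub>c A x"
  unfolding cscale_op_def
  by (subst bounded_linear_Blinfun_apply)
    (auto intro: bounded_linear_compose[OF bounded_linear_cscale] blinfun.bounded_linear_right)

lift_definition shift_map :: "int \<Rightarrow> ell2 \<Rightarrow> ell2" is "\<lambda>n x k. x (k - n)"
  by (rule square_summable_shift)

lemma coord_shift_map [simp]: "coord (shift_map n x) k = coord x (k - n)"
  by (simp add: shift_map.rep_eq)

lemma norm_shift_map: "norm (shift_map n x) = norm x"
proof -
  have "bij_betw (\<lambda>k::int. k - n) UNIV UNIV"
    by (rule bij_betw_byWitness[of _ "\<lambda>k. k + n"]) auto
  from infsum_reindex_bij_betw[OF this, of "\<lambda>k. (cmod (coord x k))\<^sup>2"]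
  show ?thesis by (simp add: norm_ell2_eq)
qed

text \<open>\<open>shift n\<close> is the integer power \<open>V\<^sup>n\<close> of the bilateral shift \<open>V = shift 1\<close>:
  see \<open>shift_basis_vec\<close>, \<open>shift_0\<close> and \<open>shift_add\<close>.\<close>

lift_definition shift :: "int \<Rightarrow> ell2_op" is shift_map
proof -
  fix n :: int
  show "bounded_linear (shift_map n)"
    by (rule bounded_linear_intro[where K = 1])
      (auto intro!: ell2_eqI simp: norm_shift_map)
qed

lemma coord_shift [simp]: "coord (shift n x) k = coord x (k - n)"
  by (simp add: shift.rep_eq)

lemma shift_basis_vec: "shift n (basis_vec l) = basis_vec (l + n)"
  by (rule ell2_eqI) (auto simp: coord_basis_vec)

lemma shift_0: "shift 0 = id_blinfun"
  by (rule blinfun_eqI, rule ell2_eqI) simp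

lemma shift_add: "shift (m + n) = shift m o\<^sub>L shift n"
  by (rule blinfun_eqI, rule ell2_eqI) (simp add: algebra_simps)

text \<open>The possibly unbounded diagonal operator \<open>b(L)\<close>, extended by zero from its
  maximal domain to a total function. The domain contains \<open>finite_vecs\<close>, and it is
  the whole space if \<open>b\<close> is bounded.\<close>

lift_definition diag_map :: "(int \<Rightarrow> complex) \<Rightarrow> ell2 \<Rightarrow> ell2" is
  "\<lambda>b x. if square_summable (\<lambda>l. b l * x l) then (\<lambda>l. b l * x l) else (\<lambda>_. 0)"
  by auto

definition diag_op :: "(int \<Rightarrow> complex) \<Rightarrow> ell2_op" where
  "diag_op b = Blinfun (diag_map b)"

lemma coord_diag_map_finite:
  assumes "x \<in> finite_vecs"
  shows "coord (diag_map b x) l = b l * coord x l"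
proof -
  have fin: "finite {l. coord x l \<noteq> 0}" using assms by (simp add: finite_vecs_iff)
  have "square_summable (\<lambda>l. b l * coord x l)"
    unfolding square_summable_def
    by (rule summable_on_cong_neutral[THEN iffD1, OF _ _ _ summable_on_finite[OF fin]]) auto
  then show ?thesis by (simp add: diag_map.rep_eq)
qed

lemma coord_diag_map_bounded:
  assumes "bounded (range b)"
  shows "coord (diag_map b x) l = b l * coord x l"
proof -
  obtain C where C: "\<And>l. cmod (b l) \<le> C" using assms by (auto simp: bounded_iff)
  have "square_summable (\<lambda>l. b l * coord x l)"
    by (rule square_summable_bound[of "coord x" _ C]) (auto simp: norm_mult C mult_right_mono)
  then show ?thesis by (simp add: diag_map.rep_eq)
qed

lemma diag_op_apply:
  assumes "bounded (range b)"
  shows "diag_op b x = diag_map b x"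
proof -
  obtain C where C: "\<And>l. cmod (b l) \<le> C" using assms by (auto simp: bounded_iff)
  have C0: "C \<ge> 0" using C[of 0] norm_ge_zero[of "b 0"] by linarith
  have "bounded_linear (diag_map b)"
  proof (rule bounded_linear_intro[where K = C])
    show "norm (diag_map b x) \<le> norm x * C" for x
      using norm_ell2_le[of "diag_map b x" C x] C C0
      by (simp add: coord_diag_map_bounded[OF assms] norm_mult mult_right_mono mult.commute)
  qed (auto intro!: ell2_eqI simp: coord_diag_map_bounded[OF assms] algebra_simps)
  then show ?thesis by (simp add: diag_op_def bounded_linear_Blinfun_apply)
qed

lemma coord_diag_op [simp]:
  "bounded (range b) \<Longrightarrow> coord (diag_op b x) l = b l * coord x l"
  by (simp add: diag_op_apply coord_diag_map_bounded)

lemma diag_op_basis_vec: "bounded (range b) \<Longrightarrow> diag_op b (basis_vec l) = b l *\<^sub>c basis_vec l"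
  by (rule ell2_eqI) (auto simp: coord_basis_vec)

lemma bounded_range_periodic:
  fixes b :: "int \<Rightarrow> complex"
  assumes "j > 0" "\<And>l. b (l + int j) = b l"
  shows "bounded (range b)"
proof -
  have 1: "b (l + int j * int m) = b l" for l m
    by (induction m) (simp_all add: algebra_simps, metis assms(2) add.assoc add.commute)
  have 2: "b (l + int j * m) = b l" for l m
  proof (cases "m \<ge> 0")
    case True
    then show ?thesis using 1[of l "nat m"] by simp
  next
    case False
    then show ?thesis using 1[of "l + int j * m" "nat (- m)"] by (simp add: algebra_simps)
  qed
  have "b l = b (l mod int j)" for l
    using 2[of "l mod int j" "l div int j"] by (simp add: mod_mult_div_eq)
  then have "range b \<subseteq> b ` {0..<int j}"
    using assms(1) by (metis (no_types, lifting) atLeastLessThan_iff imageI image_subsetI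
        of_nat_0_less_iff pos_mod_bound pos_mod_sign)
  then show ?thesis
    by (meson bounded_subset finite_imp_bounded finite_imageI finite_atLeastLessThan_int)
qed

section \<open>Bunce-Deddens algebras\<close>

text \<open>Every bounded operator has exactly one adjoint, so the condition on \<open>is_adjoint\<close>
  is closure under taking adjoints.\<close>

definition star_subalgebra :: "ell2_op set \<Rightarrow> bool" where
  "star_subalgebra S \<longleftrightarrow> S \<subseteq> bounded_ops \<and> 0 \<in> S \<and>
     (\<forall>A\<in>S. \<forall>B\<in>S. A + B \<in> S) \<and>
     (\<forall>c. \<forall>A\<in>S. cscale_op c A \<in> S) \<and>
     (\<forall>A\<in>S. \<forall>B\<in>S. A o\<^sub>L B \<in> S) \<and>
     (\<forall>A\<in>S. \<forall>B. is_adjoint A B \<longrightarrow> B \<in> S)"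

definition cstar_subalgebra :: "ell2_op set \<Rightarrow> bool" where
  "cstar_subalgebra S \<longleftrightarrow> star_subalgebra S \<and> closed S"

definition diag_alg :: "supernatural \<Rightarrow> ell2_op set" where
  "diag_alg N = {diag_op b | b. \<exists>j. sn_dvd j N \<and> (\<forall>l. b (l + int j) = b l)}"

definition diag_closure :: "supernatural \<Rightarrow> ell2_op set" where
  "diag_closure N = closure (diag_alg N)"

definition BD :: "supernatural \<Rightarrow> ell2_op set" where
  "BD N = cstar_subalgebra hull ({shift 1} \<union> diag_alg N)"

definition BD_alg :: "supernatural \<Rightarrow> ell2_op set" where
  "BD_alg N = star_subalgebra hull ({shift 1, shift (- 1)} \<union> diag_alg N)"

text \<open>The hulls above are genuinely the smallest such subalgebras of \<open>bounded_ops\<close>.\<close>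

lemma is_adjoint_bounded_ops: "is_adjoint A B \<Longrightarrow> B \<in> bounded_ops"
proof -
  assume AB: "is_adjoint A B"
  have right_scale: "cinner x (c *\<^sub>c y) = cnj c * cinner x y" for x y c
    by (metis cinner_commute cinner_cscale_left complex_cnj_mult)
  show "B \<in> bounded_ops"
    unfolding bounded_ops_def mem_Collect_eq
  proof (intro allI)
    fix c x
    have "cinner y (B (c *\<^sub>c x)) = cinner y (c *\<^sub>c B x)" for y
      using AB unfolding is_adjoint_def by (metis right_scale)
    then have "inner y (B (c *\<^sub>c x)) = inner y (c *\<^sub>c B x)" for y
      by (simp add: inner_ell2_def)
    then have "inner y (B (c *\<^sub>c x) - c *\<^sub>c B x) = 0" for y
      by (simp only: inner_diff_right)
    then show "B (c *\<^sub>c x) = c *\<^sub>c B x"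
      by (metis inner_eq_zero_iff right_minus_eq)
  qed
qed

lemma cstar_subalgebra_bounded_ops: "cstar_subalgebra bounded_ops"
proof -
  have "closed bounded_ops"
  proof -
    have "bounded_ops = (\<Inter>c. \<Inter>x. {A :: ell2_op. A (c *\<^sub>c x) = c *\<^sub>c A x})"
      by (auto simp: bounded_ops_def)
    moreover have "closed {A :: ell2_op. A (c *\<^sub>c x) = c *\<^sub>c A x}" for c x
      by (intro closed_Collect_eq continuous_intros
          bounded_linear.continuous_on[OF bounded_linear_cscale])
    ultimately show ?thesis by (metis (no_types, lifting) closed_INT)
  qed
  moreover have "star_subalgebra bounded_ops"
    unfolding star_subalgebra_def
  proof (intro conjI ballI allI impI)
    fix A B :: ell2_op and c :: complex
    assume A: "A \<in> bounded_ops"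
    show "cscale_op c A \<in> bounded_ops"
      using A by (auto simp: bounded_ops_def mult.left_commute intro: ell2_eqI)
    show "B \<in> bounded_ops" if "is_adjoint A B" using that by (rule is_adjoint_bounded_ops)
    assume B: "B \<in> bounded_ops"
    show "A + B \<in> bounded_ops"
      using A B by (auto simp: bounded_ops_def blinfun.add_left distrib_left intro: ell2_eqI)
    show "A o\<^sub>L B \<in> bounded_ops"
      using A B by (auto simp: bounded_ops_def)
  qed (auto simp: bounded_ops_def intro: ell2_eqI)
  ultimately show ?thesis by (simp add: cstar_subalgebra_def)
qed

lemma shift_bounded_ops: "shift n \<in> bounded_ops"
  unfolding bounded_ops_def by (auto intro: ell2_eqI)

lemma diag_alg_bounded_ops: "diag_alg N \<subseteq> bounded_ops"
proof
  fix A assume "A \<in> diag_alg N"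
  then obtain b j where b: "A = diag_op b" "j > 0" "\<And>l. b (l + int j) = b l"
    by (auto simp: diag_alg_def sn_dvd_def)
  have "bounded (range b)" using b(2,3) by (rule bounded_range_periodic)
  then show "A \<in> bounded_ops"
    by (auto simp: bounded_ops_def b(1) mult.left_commute intro: ell2_eqI)
qed

lemma star_subalgebra_Inter:
  assumes "T \<noteq> {}" "\<And>S. S \<in> T \<Longrightarrow> star_subalgebra S"
  shows "star_subalgebra (\<Inter>T)"
proof -
  obtain S where "S \<in> T" using assms(1) by blast
  then have "\<Inter>T \<subseteq> bounded_ops" using assms(2)[of S] by (auto simp: star_subalgebra_def)
  then show ?thesis
    unfolding star_subalgebra_def using assms(2)[unfolded star_subalgebra_def]
    by (simp add: Ball_def) blast
qed

lemma star_subalgebra_BD_alg: "star_subalgebra (BD_alg N)"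
  unfolding BD_alg_def hull_def
proof (rule star_subalgebra_Inter)
  have "bounded_ops \<in> {t. star_subalgebra t \<and> {shift 1, shift (- 1)} \<union> diag_alg N \<subseteq> t}"
    using cstar_subalgebra_bounded_ops shift_bounded_ops diag_alg_bounded_ops
    by (simp add: cstar_subalgebra_def)
  then show "{t. star_subalgebra t \<and> {shift 1, shift (- 1)} \<union> diag_alg N \<subseteq> t} \<noteq> {}"
    by blast
qed simp

lemma cstar_subalgebra_BD: "cstar_subalgebra (BD N)"
proof -
  have "bounded_ops \<in> {t. cstar_subalgebra t \<and> {shift 1} \<union> diag_alg N \<subseteq> t}"
    using cstar_subalgebra_bounded_ops shift_bounded_ops diag_alg_bounded_ops by simp
  then have "star_subalgebra (BD N)"
    unfolding BD_def hull_def
    by (intro star_subalgebra_Inter) (blast, simp add: cstar_subalgebra_def)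
  moreover have "closed (BD N)"
    unfolding BD_def hull_def by (intro closed_Inter) (simp add: cstar_subalgebra_def)
  ultimately show ?thesis by (simp add: cstar_subalgebra_def)
qed

section \<open>Derivations\<close>

text \<open>A derivation is represented by a function on all operators whose values outside
  \<open>BD_alg N\<close> are irrelevant.\<close>

definition derivation :: "supernatural \<Rightarrow> (ell2_op \<Rightarrow> ell2_op) \<Rightarrow> bool" where
  "derivation N \<delta> \<longleftrightarrow>
     (\<forall>a\<in>BD_alg N. \<delta> a \<in> BD N) \<and>
     (\<forall>a\<in>BD_alg N. \<forall>b\<in>BD_alg N. \<delta> (a + b) = \<delta> a + \<delta> b) \<and>
     (\<forall>c. \<forall>a\<in>BD_alg N. \<delta> (cscale_op c a) = cscale_op c (\<delta> a)) \<and>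
     (\<forall>a\<in>BD_alg N. \<forall>b\<in>BD_alg N. \<delta> (a o\<^sub>L b) = (\<delta> a o\<^sub>L b) + (a o\<^sub>L \<delta> b))"

definition rho :: "real \<Rightarrow> ell2_op \<Rightarrow> ell2_op" where
  "rho \<theta> b = diag_op (\<lambda>l. exp (\<i> * \<theta> * l)) o\<^sub>L b o\<^sub>L diag_op (\<lambda>l. exp (- \<i> * \<theta> * l))"

lemma bounded_range_phase:
  "bounded (range (\<lambda>l::int. exp (\<i> * complex_of_real \<theta> * complex_of_int l)))"
  "bounded (range (\<lambda>l::int. exp (- \<i> * complex_of_real \<theta> * complex_of_int l)))"
  by (auto simp: bounded_iff norm_exp_eq_Re intro!: exI[of _ 1])

lemma rho_inverse: "rho (- \<theta>) (rho \<theta> b) = b"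
proof -
  have "exp (- \<i> * \<theta> * l) * (exp (\<i> * \<theta> * l) * z) = z" for l :: int and z :: complex
    by (simp add: mult.assoc[symmetric] mult_exp_exp)
  then have cancel: "diag_op (\<lambda>l. exp (- \<i> * \<theta> * l)) (diag_op (\<lambda>l. exp (\<i> * \<theta> * l)) x) = x" for x
    by (intro ell2_eqI) (simp only: coord_diag_op bounded_range_phase)
  show ?thesis
  proof (rule blinfun_eqI)
    fix x
    show "rho (- \<theta>) (rho \<theta> b) x = b x"
      unfolding rho_def by simp (use cancel in simp)
  qed
qed

lemma inv_rho: "inv (rho \<theta>) = rho (- \<theta>)"
  by (rule inv_equality) (use rho_inverse[of \<theta>] rho_inverse[of "- \<theta>"] in auto)

definition covariant_derivation :: "supernatural \<Rightarrow> int \<Rightarrow> (ell2_op \<Rightarrow> ell2_op) \<Rightarrow> bool" where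
  "covariant_derivation N n \<delta> \<longleftrightarrow> derivation N \<delta> \<and>
     (\<forall>\<theta>\<in>{0..<2 * pi}. \<forall>b\<in>BD_alg N.
        inv (rho \<theta>) (\<delta> (rho \<theta> b)) = cscale_op (exp (- \<i> * n * \<theta>)) (\<delta> b))"

text \<open>\<open>A\<close> is the bounded extension of the operator \<open>T\<close> with domain \<open>finite_vecs\<close>
  (unique, since \<open>finite_vecs\<close> is dense).\<close>

definition bounded_extension :: "(ell2 \<Rightarrow> ell2) \<Rightarrow> ell2_op \<Rightarrow> bool" where
  "bounded_extension T A \<longleftrightarrow> (\<forall>x\<in>finite_vecs. A x = T x)"

text \<open>The commutator \<open>[V\<^sup>n \<eta>(L), a]\<close>, to be considered on \<open>finite_vecs\<close>.\<close>

definition commutator :: "int \<Rightarrow> (int \<Rightarrow> complex) \<Rightarrow> ell2_op \<Rightarrow> ell2 \<Rightarrow> ell2" where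
  "commutator n \<eta> a x = shift n (diag_map \<eta> (a x)) - a (shift n (diag_map \<eta> x))"

definition in_diag_closure :: "supernatural \<Rightarrow> (int \<Rightarrow> complex) \<Rightarrow> bool" where
  "in_diag_closure N b \<longleftrightarrow> (\<exists>A\<in>diag_closure N. bounded_extension (diag_map b) A)"

definition admissible :: "supernatural \<Rightarrow> int \<Rightarrow> (int \<Rightarrow> complex) \<Rightarrow> bool" where
  "admissible N n \<eta> \<longleftrightarrow>
     (if \<not> sn_finite N \<and> n \<noteq> 0 \<or> sn_finite N \<and> \<not> int (sn_value N) dvd n
      then in_diag_closure N \<eta>
      else in_diag_closure N (\<lambda>l. \<eta> (l + 1) - \<eta> l))"

end

theory Submission
  imports Defs
begin

text \<open>Conjugation by \<open>rho \<theta>\<close> forces an \<open>n\<close>-covariant derivation \<open>\<delta>\<close> to send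
  \<open>V\<close> to \<open>V\<^sup>n\<^sup>+\<^sup>1 \<beta>(L)\<close> and a diagonal \<open>b(L)\<close> to \<open>V\<^sup>n \<gamma>\<^sub>b(L)\<close>, so \<open>\<delta> = [V\<^sup>n \<eta>(L), \<cdot>]\<close> amounts to
  \<open>\<eta>(l + 1) - \<eta>(l) = \<beta>(l)\<close> and \<open>\<eta>(l) (b(l) - b(l + n)) = \<gamma>\<^sub>b(l)\<close>. If some divisor \<open>j\<close> of \<open>N\<close>
  does not divide \<open>n\<close>, the second equation for the character \<open>b(l) = exp(2\<pi>il/j)\<close> determines
  \<open>\<eta>\<close>, and \<open>\<delta>(bc) = \<delta>(cb)\<close> and \<open>bV = b(1) Vb\<close> yield the remaining equations. Otherwise \<open>V\<^sup>n\<close>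
  commutes with every periodic diagonal, so \<open>\<delta>\<close> kills all projections among these, hence
  \<open>\<gamma>\<^sub>b = 0\<close> for all \<open>b\<close>, and \<open>\<eta>\<close> is any primitive of \<open>\<beta>\<close>. That \<open>\<eta>\<close>, respectively \<open>\<beta>\<close>, lies in
  the closure of the periodic sequences holds because every element of \<open>B(N)\<close> is a norm limit
  of operators commuting with some \<open>V\<^sup>j\<close>, \<open>j | N\<close>, and taking a diagonal of the matrix is contractive.\<close>

section \<open>Divisors of a supernatural number\<close>

lemma sn_dvd_1: "sn_dvd 1 N"
  by (simp add: sn_dvd_def zero_enat_def[symmetric])

text \<open>Exponents of an lcm are maxima of exponents. Hence any two divisors of N have a common
  multiple that divides N, which later gives two periodic operators a common period.\<close>

lemma sn_dvd_lcm:
  assumes "sn_dvd i N" "sn_dvd j N"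
  shows "sn_dvd (lcm i j) N"
  using assms unfolding sn_dvd_def
  by (auto simp: lcm_pos_nat multiplicity_lcm max_def)

text \<open>Every nonzero exponent contributes at least 1, so m + 1 primes with nonzero exponent
  already push the sum above m, and one infinite exponent makes the sum infinite. Conversely the sum
  reduces to finitely many finite terms.\<close>

lemma sn_finite_iff:
  "sn_finite N \<longleftrightarrow> finite {p. prime p \<and> N p \<noteq> 0} \<and> (\<forall>p. prime p \<longrightarrow> N p \<noteq> \<infinity>)"
proof
  assume fin: "sn_finite N"
  then obtain m where m: "(\<Sum>\<^sub>\<infinity>p\<in>{p. prime p}. N p) = enat m"
    unfolding sn_finite_def by (metis less_infinityE)
  have le: "sum N F \<le> enat m" if "finite F" "F \<subseteq> {p. prime p}" for F
    unfolding m[symmetric] nonneg_infsum_complete[of "{p. prime p}" N, simplified]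
    by (rule SUP_upper) (use that in auto)
  have "N p \<noteq> \<infinity>" if "prime p" for p
    using le[of "{p}"] that by (cases "N p") auto
  moreover have "finite {p. prime p \<and> N p \<noteq> 0}"
  proof (rule ccontr)
    assume "infinite {p. prime p \<and> N p \<noteq> 0}"
    then obtain F where F: "finite F" "card F = Suc m" "F \<subseteq> {p. prime p \<and> N p \<noteq> 0}"
      by (metis infinite_arbitrarily_large)
    have "enat (Suc m) = (\<Sum>p\<in>F. 1)"
      using F(2) by (simp add: of_nat_eq_enat)
    also have "\<dots> \<le> sum N F"
      by (rule sum_mono) (use F(3) in \<open>auto simp: one_eSuc ileI1 i0_less\<close>)
    also have "\<dots> \<le> enat m"
      by (rule le) (use F in auto)
    finally show False by simp
  qed
  ultimately show "finite {p. prime p \<and> N p \<noteq> 0} \<and> (\<forall>p. prime p \<longrightarrow> N p \<noteq> \<infinity>)" by blast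
next
  assume fin: "finite {p. prime p \<and> N p \<noteq> 0} \<and> (\<forall>p. prime p \<longrightarrow> N p \<noteq> \<infinity>)"
  have "(\<Sum>\<^sub>\<infinity>p\<in>{p. prime p}. N p) = (\<Sum>\<^sub>\<infinity>p\<in>{p. prime p \<and> N p \<noteq> 0}. N p)"
    by (rule infsum_cong_neutral) auto
  also have "\<dots> = (\<Sum>p\<in>{p. prime p \<and> N p \<noteq> 0}. N p)"
    using fin by simp
  also have "\<dots> = (\<Sum>p\<in>{p. prime p \<and> N p \<noteq> 0}. enat (the_enat (N p)))"
    by (rule sum.cong) (use fin in auto)
  also have "\<dots> = enat (\<Sum>p\<in>{p. prime p \<and> N p \<noteq> 0}. the_enat (N p))"
    by (induction "{p. prime p \<and> N p \<noteq> 0}" rule: infinite_finite_induct)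
      (simp_all add: of_nat_eq_enat[symmetric])
  finally show "sn_finite N" by (simp add: sn_finite_def)
qed

text \<open>Both sides compare exponents prime by prime, since for finite N the multiplicity of p in
  \<open>sn_value N\<close> is exactly \<open>N p\<close>.\<close>

lemma sn_dvd_iff_dvd_value:
  assumes "sn_finite N"
  shows "sn_dvd j N \<longleftrightarrow> j dvd sn_value N"
proof -
  let ?S = "{p. prime p \<and> N p \<noteq> 0}"
  have fin: "finite ?S" and ninf: "\<And>p. prime p \<Longrightarrow> N p \<noteq> \<infinity>"
    using assms by (auto simp: sn_finite_iff)
  have pos: "sn_value N \<noteq> 0"
    unfolding sn_value_def using fin by (auto simp: prime_gt_0_nat)
  have mult: "enat (multiplicity p (sn_value N)) = N p" if "prime p" for p
  proof -
    have "multiplicity p (sn_value N) = (if p \<in> ?S then the_enat (N p) else 0)"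
      unfolding sn_value_def using that by (intro multiplicity_prod_prime_powers fin) auto
    then show ?thesis using that ninf[OF that] by (auto simp: zero_enat_def)
  qed
  show ?thesis
  proof
    assume j: "sn_dvd j N"
    show "j dvd sn_value N"
    proof (rule multiplicity_le_imp_dvd)
      show "j \<noteq> 0" using j by (simp add: sn_dvd_def)
      show "multiplicity p j \<le> multiplicity p (sn_value N)" if "prime p" for p
        using j that mult[OF that] by (metis enat_ord_simps(1) sn_dvd_def)
    qed
  next
    assume dvd: "j dvd sn_value N"
    then have "j > 0" using pos by (auto intro: gr0I)
    moreover have "enat (multiplicity p j) \<le> N p" if "prime p" for p
      using dvd_imp_multiplicity_le[OF dvd pos, of p] mult[OF that] by (metis enat_ord_simps(1))
    ultimately show "sn_dvd j N" by (simp add: sn_dvd_def)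
  qed
qed

lemma sn_dvd_prime_power:
  assumes p: "prime p" and k: "enat k \<le> N p"
  shows "sn_dvd (p ^ k) N"
proof -
  have "enat (multiplicity q (p ^ k)) \<le> N q" if q: "prime q" for q
  proof (cases "q = p")
    case True
    then show ?thesis using p k by (simp add: multiplicity_same_power)
  next
    case False
    then have "multiplicity q (p ^ k) = 0"
      using p q by (intro multiplicity_distinct_prime_power)
    then show ?thesis by (simp only: zero_enat_def[symmetric] zero_le)
  qed
  then show ?thesis using prime_gt_0_nat[OF p] by (simp add: sn_dvd_def)
qed

text \<open>Large divisors have two sources: a prime with infinite exponent supplies the power p^m,
  which is at least 2^m > m; otherwise infinitely many primes occur in N and one of them exceeds
  m.\<close>

lemma sn_dvd_unbounded:
  assumes "\<not> sn_finite N"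
  shows "\<exists>j. sn_dvd j N \<and> m < j"
proof (cases "\<exists>p. prime p \<and> N p = \<infinity>")
  case True
  then obtain p where p: "prime p" "N p = \<infinity>" by blast
  have "m < 2 ^ m" by (rule less_exp)
  also have "\<dots> \<le> p ^ m"
    using prime_ge_2_nat[OF p(1)] by (intro power_mono) auto
  finally show ?thesis
    using sn_dvd_prime_power[OF p(1), of m N] p(2) by auto
next
  case False
  then have "infinite {p. prime p \<and> N p \<noteq> 0}"
    using assms by (auto simp: sn_finite_iff)
  then obtain p where p: "prime p" "N p \<noteq> 0" "m < p"
    unfolding infinite_nat_iff_unbounded by blast
  have "enat 1 \<le> N p"
    using p(2) by (cases "N p") (auto simp: zero_enat_def)
  then show ?thesis
    using sn_dvd_prime_power[OF p(1), of 1 N] p(3) by auto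
qed

text \<open>This restates the case distinction of \<open>admissible\<close> in the form that the
  analysis uses. For finite N the largest divisor \<open>sn_value N\<close> decides; for infinite N
  a divisor beyond \<bar>n\<bar> cannot divide a nonzero n.\<close>

lemma ex_sn_dvd_not_dvd_iff:
  "(\<exists>j. sn_dvd j N \<and> \<not> int j dvd n) \<longleftrightarrow>
     \<not> sn_finite N \<and> n \<noteq> 0 \<or> sn_finite N \<and> \<not> int (sn_value N) dvd n"
proof (cases "sn_finite N")
  case True
  then show ?thesis
    using sn_dvd_iff_dvd_value[OF True] by (metis dvd_refl dvd_trans int_dvd_int_iff)
next
  case False
  have "\<exists>j. sn_dvd j N \<and> \<not> int j dvd n" if n: "n \<noteq> 0"
  proof -
    obtain j where j: "sn_dvd j N" "nat \<bar>n\<bar> < j"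
      using sn_dvd_unbounded[OF False] by blast
    have "\<not> int j dvd n"
      using n j(2) dvd_imp_le_int[of n "int j"] by linarith
    then show ?thesis using j(1) by blast
  qed
  then show ?thesis using False by (cases "n = 0") simp_all
qed

section \<open>Adjoints\<close>

lemma cinner_add_right: "cinner x (y + z) = cinner x y + cinner x z"
  by (metis cinner_add_left cinner_commute complex_cnj_add)

lemma cinner_cscale_right: "cinner x (c *\<^sub>c y) = cnj c * cinner x y"
  by (metis cinner_commute cinner_cscale_left complex_cnj_mult)

lemma cinner_ext:
  assumes "\<And>z. cinner z x = cinner z y"
  shows "x = y"
proof -
  have "inner z (x - y) = 0" for z
    unfolding inner_diff_right[of z x y] using assms[of z] by (simp add: inner_ell2_def)
  then show ?thesis by (metis inner_eq_zero_iff right_minus_eq)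
qed

lemma is_adjoint_sym: "is_adjoint A B \<Longrightarrow> is_adjoint B A"
  unfolding is_adjoint_def by (metis cinner_commute)

lemma is_adjoint_unique: "is_adjoint A B \<Longrightarrow> is_adjoint A C \<Longrightarrow> B = C"
  unfolding is_adjoint_def by (metis blinfun_eqI cinner_ext)

lemma is_adjoint_add: "is_adjoint A B \<Longrightarrow> is_adjoint C D \<Longrightarrow> is_adjoint (A + C) (B + D)"
  by (simp add: is_adjoint_def blinfun.add_left cinner_add_left cinner_add_right)

lemma is_adjoint_cscale: "is_adjoint A B \<Longrightarrow> is_adjoint (cscale_op c A) (cscale_op (cnj c) B)"
  by (simp add: is_adjoint_def cinner_cscale_left cinner_cscale_right)

lemma is_adjoint_compose: "is_adjoint A B \<Longrightarrow> is_adjoint C D \<Longrightarrow> is_adjoint (A o\<^sub>L C) (D o\<^sub>L B)"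
  by (simp add: is_adjoint_def)

lemma is_adjoint_shift: "is_adjoint (shift n) (shift (- n))"
  unfolding is_adjoint_def
proof (intro allI)
  fix x y
  have "bij_betw (\<lambda>k::int. k + n) UNIV UNIV"
    by (rule bij_betw_byWitness[of _ "\<lambda>k. k - n"]) auto
  from infsum_reindex_bij_betw[OF this, of "\<lambda>k. coord x (k - n) * cnj (coord y k)"]
  show "cinner (shift n x) y = cinner x (shift (- n) y)"
    by (simp add: cinner_def)
qed

lemma is_adjoint_diag_op:
  assumes "bounded (range b)"
  shows "is_adjoint (diag_op b) (diag_op (\<lambda>l. cnj (b l)))"
proof -
  have "bounded (range (\<lambda>l. cnj (b l)))"
    using assms by (simp add: bounded_iff)
  then show ?thesis
    using assms by (simp add: is_adjoint_def cinner_def mult.left_commute mult.assoc)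
qed

text \<open>Cauchy-Schwarz bounds \<parallel>Bx\<parallel>^2 = Re <ABx, x> by
  \<parallel>A\<parallel> \<parallel>Bx\<parallel> \<parallel>x\<parallel>, and one factor
  \<parallel>Bx\<parallel> cancels.\<close>

lemma norm_adjoint_le:
  assumes "is_adjoint A B"
  shows "norm B \<le> norm A"
proof (rule norm_blinfun_bound)
  fix x
  have "(norm (B x))\<^sup>2 = inner (A (B x)) x"
    using assms by (simp add: power2_norm_eq_inner inner_ell2_def is_adjoint_def)
  also have "\<dots> \<le> norm (A (B x)) * norm x"
    by (rule norm_cauchy_schwarz)
  also have "\<dots> \<le> (norm A * norm (B x)) * norm x"
    by (intro mult_right_mono norm_blinfun) simp
  finally have "norm (B x) * norm (B x) \<le> norm (B x) * (norm A * norm x)"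
    by (simp add: power2_eq_square mult_ac)
  then show "norm (B x) \<le> norm A * norm x"
    by (cases "norm (B x) = 0") (simp, use mult_le_cancel_left_pos[of "norm (B x)"] in auto)
qed simp

lemma is_adjoint_uminus: "is_adjoint A B \<Longrightarrow> is_adjoint (- A) (- B)"
proof -
  have "- A = cscale_op (- 1) A" for A
    by (rule blinfun_eqI, rule ell2_eqI) (simp add: blinfun.minus_left)
  then show "is_adjoint A B \<Longrightarrow> is_adjoint (- A) (- B)"
    using is_adjoint_cscale[of A B "- 1"] by simp
qed

lemma is_adjoint_diff: "is_adjoint A B \<Longrightarrow> is_adjoint C D \<Longrightarrow> is_adjoint (A - C) (B - D)"
  using is_adjoint_add[OF _ is_adjoint_uminus, of A B C D] by simp

section \<open>Operators are determined by their matrix\<close>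

lemma norm_basis_vec: "norm (basis_vec l) = 1"
proof -
  have "(\<Sum>\<^sub>\<infinity>k. (cmod (coord (basis_vec l) k))\<^sup>2) = (\<Sum>\<^sub>\<infinity>k\<in>{l}. 1)"
    by (rule infsum_cong_neutral) (auto simp: coord_basis_vec)
  then show ?thesis by (simp add: norm_ell2_eq)
qed

lemma norm_cscale: "norm (c *\<^sub>c x) = cmod c * norm x"
  by (simp add: norm_ell2_eq norm_mult power_mult_distrib infsum_cmult_right' real_sqrt_mult)

lemma cmod_coord_le_norm: "cmod (coord x k) \<le> norm x"
  using norm_ell2_le[of "coord x k *\<^sub>c basis_vec k" 1 x]
  by (simp add: norm_cscale norm_basis_vec coord_basis_vec)

lemma cmod_coord_basis_le_norm: "cmod (coord (blinfun_apply A (basis_vec l)) k) \<le> norm A"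
  using cmod_coord_le_norm[of "A (basis_vec l)" k] norm_blinfun[of A "basis_vec l"]
  by (simp add: norm_basis_vec)

text \<open>Truncating x to a finite set F leaves as squared error the tail of the series of squared
  moduli, which is small for suitable F.\<close>

lemma finite_vecs_dense: "closure finite_vecs = UNIV"
proof -
  have "x \<in> closure finite_vecs" for x
    unfolding closure_approachable
  proof (intro allI impI)
    fix e :: real
    assume e: "e > 0"
    let ?f = "\<lambda>k. (cmod (coord x k))\<^sup>2"
    have summable: "?f summable_on UNIV"
      using square_summable_coord[of x] by (simp only: square_summable_def)
    \<comment> \<open>The approximation comes with a weak inequality, so the tolerance is taken as
      \<open>(e/2)\<^sup>2\<close> to end strictly below e.\<close>
    obtain F where F: "finite F" "dist (sum ?f F) (infsum ?f UNIV) \<le> (e/2)\<^sup>2"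
      using has_sum_finite_approximation[OF has_sum_infsum[OF summable], of "(e/2)\<^sup>2"] e by auto
    define y where "y = (\<Sum>k\<in>F. coord x k *\<^sub>c basis_vec k)"
    have y: "coord y k = (if k \<in> F then coord x k else 0)" for k
      using F(1) by (simp add: y_def coord_sum coord_basis_vec if_distrib cong: if_cong)
    have "(norm (x - y))\<^sup>2 = (\<Sum>\<^sub>\<infinity>k. (cmod (coord (x - y) k))\<^sup>2)"
      unfolding norm_ell2_eq by (simp add: infsum_nonneg)
    also have "\<dots> = infsum ?f (UNIV - F)"
      by (rule infsum_cong_neutral) (auto simp: y)
    also have "\<dots> = infsum ?f UNIV - sum ?f F"
      using F(1) summable by (simp add: infsum_Diff)
    also have "\<dots> \<le> (e/2)\<^sup>2"
      using F(2) by (simp add: dist_real_def)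
    finally have "norm (x - y) \<le> e/2"
      by (rule power2_le_imp_le) (use e in simp)
    then have "dist y x < e"
      using e by (simp add: dist_norm norm_minus_commute)
    moreover have "y \<in> finite_vecs"
      unfolding y_def finite_vecs_def using F(1) by blast
    ultimately show "\<exists>y\<in>finite_vecs. dist y x < e" by blast
  qed
  then show ?thesis by blast
qed

lemma blinfun_eqI_finite_vecs:
  fixes A B :: ell2_op
  assumes "\<And>x. x \<in> finite_vecs \<Longrightarrow> A x = B x"
  shows "A = B"
proof -
  have "closed {x. A x = B x}"
    by (intro closed_Collect_eq continuous_intros)
  then have "closure finite_vecs \<subseteq> {x. A x = B x}"
    using assms by (intro closure_minimal) auto
  then show ?thesis by (intro blinfun_eqI) (auto simp: finite_vecs_dense)
qed

text \<open>Membership in \<open>bounded_ops\<close> supplies complex linearity, which the type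
  \<open>ell2_op\<close> does not; it carries agreement on the basis over to complex combinations,
  and density does the rest.\<close>

lemma bounded_ops_eqI_basis:
  assumes "A \<in> bounded_ops" "B \<in> bounded_ops" "\<And>l. A (basis_vec l) = B (basis_vec l)"
  shows "A = B"
proof (rule blinfun_eqI_finite_vecs)
  fix x
  assume "x \<in> finite_vecs"
  then obtain F c where "x = (\<Sum>l\<in>F. c l *\<^sub>c basis_vec l)"
    by (auto simp: finite_vecs_def)
  then show "A x = B x"
    using assms by (simp add: blinfun.sum_right bounded_ops_def)
qed

section \<open>Generation of the algebras\<close>

lemma star_subalgebraD:
  assumes "star_subalgebra S"
  shows "A \<in> S \<Longrightarrow> A \<in> bounded_ops" "A \<in> S \<Longrightarrow> B \<in> S \<Longrightarrow> A + B \<in> S"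
    "A \<in> S \<Longrightarrow> cscale_op c A \<in> S" "A \<in> S \<Longrightarrow> B \<in> S \<Longrightarrow> A o\<^sub>L B \<in> S"
    "A \<in> S \<Longrightarrow> is_adjoint A B \<Longrightarrow> B \<in> S"
  using assms by (auto simp: star_subalgebra_def)

lemma cscale_op_minus_one: "cscale_op (- 1) A = - A"
  by (rule blinfun_eqI, rule ell2_eqI) (simp add: blinfun.minus_left)

lemma star_subalgebra_diff: "star_subalgebra S \<Longrightarrow> A \<in> S \<Longrightarrow> B \<in> S \<Longrightarrow> A - B \<in> S"
  using star_subalgebraD(2)[of S A "cscale_op (- 1) B"] star_subalgebraD(3)[of S B "- 1"]
  by (simp add: cscale_op_minus_one)

lemma star_subalgebra_shift:
  assumes S: "star_subalgebra S" and 1: "shift 1 \<in> S"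
  shows "shift n \<in> S"
proof -
  have m1: "shift (- 1) \<in> S"
    using star_subalgebraD(5)[OF S 1 is_adjoint_shift] .
  show ?thesis
  proof (induction n rule: int_induct[of _ 0])
    case base
    show ?case using star_subalgebraD(4)[OF S 1 m1] by (simp add: shift_add[symmetric])
  next
    case (step1 i)
    then show ?case using star_subalgebraD(4)[OF S _ 1] by (simp add: shift_add)
  next
    case (step2 i)
    then show ?case
      using star_subalgebraD(4)[OF S _ m1, of "shift i"] by (simp add: shift_add[symmetric])
  qed
qed

lemma star_subalgebra_BD: "star_subalgebra (BD N)"
  using cstar_subalgebra_BD by (simp add: cstar_subalgebra_def)

section \<open>Generators, and the inclusion of the algebraic algebra in the C*-algebra\<close>

lemma diag_alg_subset_BD_alg: "diag_alg N \<subseteq> BD_alg N"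
  unfolding BD_alg_def using hull_subset[of "{shift 1, shift (- 1)} \<union> diag_alg N"] by blast

lemma shift_in_BD_alg: "shift n \<in> BD_alg N"
proof (rule star_subalgebra_shift[OF star_subalgebra_BD_alg])
  show "shift 1 \<in> BD_alg N"
    unfolding BD_alg_def using hull_subset[of "{shift 1, shift (- 1)} \<union> diag_alg N"] by blast
qed

lemma shift_in_BD: "shift n \<in> BD N"
proof (rule star_subalgebra_shift[OF star_subalgebra_BD])
  show "shift 1 \<in> BD N"
    unfolding BD_def using hull_subset[of "{shift 1} \<union> diag_alg N"] by blast
qed

lemma diag_closure_subset_BD: "diag_closure N \<subseteq> BD N"
  unfolding diag_closure_def
proof (rule closure_minimal)
  show "diag_alg N \<subseteq> BD N"
    unfolding BD_def using hull_subset[of "{shift 1} \<union> diag_alg N"] by blast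
  show "closed (BD N)" using cstar_subalgebra_BD by (simp add: cstar_subalgebra_def)
qed

lemma diag_alg_subset_BD: "diag_alg N \<subseteq> BD N"
  using diag_closure_subset_BD closure_subset unfolding diag_closure_def by blast

lemma BD_alg_subset_BD: "BD_alg N \<subseteq> BD N"
  unfolding BD_alg_def
  by (rule hull_minimal) (auto simp: star_subalgebra_BD shift_in_BD diag_alg_subset_BD[THEN subsetD])

lemma bounded_diag_algE:
  assumes "A \<in> diag_alg N"
  obtains b j where "A = diag_op b" "bounded (range b)" "sn_dvd j N" "\<And>l. b (l + int j) = b l"
proof -
  obtain b j where "A = diag_op b" "sn_dvd j N" "\<And>l. b (l + int j) = b l"
    using assms by (auto simp: diag_alg_def)
  then show thesis using that bounded_range_periodic[of j b] by (auto simp: sn_dvd_def)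
qed

text \<open>The generation rules omit adjoints because the generators are already closed under them.
  This yields an induction principle without an adjoint case.\<close>

inductive_set BD_words :: "supernatural \<Rightarrow> ell2_op set" for N where
  shift: "shift 1 \<in> BD_words N"
| shift_inv: "shift (- 1) \<in> BD_words N"
| diag: "A \<in> diag_alg N \<Longrightarrow> A \<in> BD_words N"
| add: "A \<in> BD_words N \<Longrightarrow> B \<in> BD_words N \<Longrightarrow> A + B \<in> BD_words N"
| scale: "A \<in> BD_words N \<Longrightarrow> cscale_op c A \<in> BD_words N"
| comp: "A \<in> BD_words N \<Longrightarrow> B \<in> BD_words N \<Longrightarrow> A o\<^sub>L B \<in> BD_words N"

lemma BD_words_subset_BD_alg: "A \<in> BD_words N \<Longrightarrow> A \<in> BD_alg N"
  by (induction rule: BD_words.induct)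
    (auto intro: star_subalgebraD[OF star_subalgebra_BD_alg] shift_in_BD_alg
      diag_alg_subset_BD_alg[THEN subsetD])

text \<open>Adjunction swaps V and its inverse, conjugates a periodic sequence without changing its
  period, and respects the algebraic operations.\<close>

lemma BD_words_adjoint: "A \<in> BD_words N \<Longrightarrow> \<exists>B\<in>BD_words N. is_adjoint A B"
proof (induction rule: BD_words.induct)
  case shift
  show ?case using is_adjoint_shift[of 1] BD_words.shift_inv by blast
next
  case shift_inv
  show ?case using is_adjoint_shift[of "- 1"] BD_words.shift by (metis minus_minus)
next
  case (diag A)
  then obtain b j where b: "A = diag_op b" "bounded (range b)" "sn_dvd j N" "\<And>l. b (l + int j) = b l"
    by (rule bounded_diag_algE) blast
  have "diag_op (\<lambda>l. cnj (b l)) \<in> diag_alg N"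
    unfolding diag_alg_def using b(3,4)
    by (intro CollectI exI[of _ "\<lambda>l. cnj (b l)"] conjI exI[of _ j]) simp_all
  then show ?case using is_adjoint_diag_op[OF b(2)] b(1) BD_words.diag by blast
next
  case (add A B)
  then show ?case by (meson BD_words.add is_adjoint_add)
next
  case (scale A c)
  then show ?case by (meson BD_words.scale is_adjoint_cscale)
next
  case (comp A B)
  then show ?case by (meson BD_words.comp is_adjoint_compose)
qed

lemma BD_alg_eq_words: "BD_alg N = BD_words N"
proof
  have "0 = cscale_op 0 (shift 1)"
    by (rule blinfun_eqI, rule ell2_eqI) simp
  then have "0 \<in> BD_words N" using BD_words.scale[OF BD_words.shift] by metis
  moreover have "B \<in> BD_words N" if "A \<in> BD_words N" "is_adjoint A B" for A B
    using BD_words_adjoint[OF that(1)] is_adjoint_unique that(2) by blast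
  ultimately have "star_subalgebra (BD_words N)"
    unfolding star_subalgebra_def
    using BD_words_subset_BD_alg star_subalgebraD(1)[OF star_subalgebra_BD_alg, of _ N]
    by (auto intro: BD_words.intros)
  then show "BD_alg N \<subseteq> BD_words N"
    unfolding BD_alg_def by (intro hull_minimal) (auto intro: BD_words.intros)
qed (auto dest: BD_words_subset_BD_alg)

text \<open>A derivation is not assumed to respect adjoints, so statements about it can only be
  proved by an induction that has no adjoint case.\<close>

lemma BD_alg_induct [consumes 1, case_names shift shift_inv diag add scale comp]:
  assumes "A \<in> BD_alg N" "P (shift 1)" "P (shift (- 1))" "\<And>A. A \<in> diag_alg N \<Longrightarrow> P A"
    "\<And>A B. A \<in> BD_alg N \<Longrightarrow> B \<in> BD_alg N \<Longrightarrow> P A \<Longrightarrow> P B \<Longrightarrow> P (A + B)"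
    "\<And>c A. A \<in> BD_alg N \<Longrightarrow> P A \<Longrightarrow> P (cscale_op c A)"
    "\<And>A B. A \<in> BD_alg N \<Longrightarrow> B \<in> BD_alg N \<Longrightarrow> P A \<Longrightarrow> P B \<Longrightarrow> P (A o\<^sub>L B)"
  shows "P A"
  using assms(1) unfolding BD_alg_eq_words
  by (induction rule: BD_words.induct) (auto intro: assms(2-)[unfolded BD_alg_eq_words])

section \<open>Diagonals of elements of the Bunce-Deddens algebra\<close>

lemma blinfun_compose_assoc: "(A o\<^sub>L B) o\<^sub>L C = A o\<^sub>L (B o\<^sub>L C)"
  by (rule blinfun_eqI) simp

text \<open>An operator commutes with \<open>shift j\<close> iff its matrix is \<open>j\<close>-periodic along
  every diagonal.\<close>

definition periodic_ops :: "supernatural \<Rightarrow> ell2_op set" where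
  "periodic_ops N = {A \<in> bounded_ops. (\<exists>j. sn_dvd j N \<and> A o\<^sub>L shift (int j) = shift (int j) o\<^sub>L A) \<and>
     (\<exists>B. is_adjoint A B)}"

lemma commute_shift_dvd:
  assumes comm: "A o\<^sub>L shift (int j) = shift (int j) o\<^sub>L A" and "j dvd k"
  shows "A o\<^sub>L shift (int k) = shift (int k) o\<^sub>L A"
proof -
  obtain m where k: "k = j * m" using assms(2) by (rule dvdE)
  have "A o\<^sub>L shift (int (j * m)) = shift (int (j * m)) o\<^sub>L A"
  proof (induction m)
    case 0
    show ?case by (intro blinfun_eqI) (simp add: shift_0)
  next
    case (Suc m)
    have *: "shift (int (j * Suc m)) = shift (int j) o\<^sub>L shift (int (j * m))"
      by (simp add: shift_add[symmetric])
    have "A o\<^sub>L shift (int (j * Suc m)) = shift (int j) o\<^sub>L (A o\<^sub>L shift (int (j * m)))"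
      unfolding * by (metis comm blinfun_compose_assoc)
    then show ?case unfolding Suc * by (simp add: blinfun_compose_assoc)
  qed
  then show ?thesis by (simp add: k)
qed

lemma shift_1_in_periodic_ops: "shift 1 \<in> periodic_ops N"
proof -
  have "shift 1 o\<^sub>L shift (int 1) = shift (int 1) o\<^sub>L shift 1" by simp
  then show ?thesis
    unfolding periodic_ops_def using shift_bounded_ops sn_dvd_1 is_adjoint_shift[of 1] by blast
qed

text \<open>Two members with periods i and j both commute with the shift by lcm i j, so sums and
  products stay periodic. The adjoint required of each member is built along the same
  operations.\<close>

lemma star_subalgebra_periodic_ops: "star_subalgebra (periodic_ops N)"
proof -
  have bo: "star_subalgebra bounded_ops"
    using cstar_subalgebra_bounded_ops by (simp add: cstar_subalgebra_def)
  have common: "\<exists>j. sn_dvd j N \<and> A o\<^sub>L shift (int j) = shift (int j) o\<^sub>L A \<and>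
      B o\<^sub>L shift (int j) = shift (int j) o\<^sub>L B"
    if "A \<in> periodic_ops N" "B \<in> periodic_ops N" for A B
    using that unfolding periodic_ops_def
    by clarsimp (meson commute_shift_dvd dvd_lcm1 dvd_lcm2 sn_dvd_lcm)
  have adj: "\<exists>B. is_adjoint A B" if "A \<in> periodic_ops N" for A
    using that by (simp add: periodic_ops_def)
  have bounded: "A \<in> bounded_ops" if "A \<in> periodic_ops N" for A
    using that by (simp add: periodic_ops_def)
  have add: "A + B \<in> periodic_ops N" if AB: "A \<in> periodic_ops N" "B \<in> periodic_ops N" for A B
  proof -
    obtain j where j: "sn_dvd j N" "A o\<^sub>L shift (int j) = shift (int j) o\<^sub>L A"
        "B o\<^sub>L shift (int j) = shift (int j) o\<^sub>L B"
      using common[OF AB] by blast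
    have "(A + B) o\<^sub>L shift (int j) = shift (int j) o\<^sub>L (A + B)"
      using j(2,3) by (simp add: bounded_bilinear.add_left[OF bounded_bilinear_blinfun_compose]
          bounded_bilinear.add_right[OF bounded_bilinear_blinfun_compose])
    then show ?thesis
      using j(1) adj[OF AB(1)] adj[OF AB(2)] is_adjoint_add
        star_subalgebraD(2)[OF bo bounded[OF AB(1)] bounded[OF AB(2)]]
      by (fastforce simp: periodic_ops_def)
  qed
  have comp: "A o\<^sub>L B \<in> periodic_ops N" if AB: "A \<in> periodic_ops N" "B \<in> periodic_ops N" for A B
  proof -
    obtain j where j: "sn_dvd j N" "A o\<^sub>L shift (int j) = shift (int j) o\<^sub>L A"
        "B o\<^sub>L shift (int j) = shift (int j) o\<^sub>L B"
      using common[OF AB] by blast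
    have "(A o\<^sub>L B) o\<^sub>L shift (int j) = shift (int j) o\<^sub>L (A o\<^sub>L B)"
      using j(2,3) by (metis blinfun_compose_assoc)
    then show ?thesis
      using j(1) adj[OF AB(1)] adj[OF AB(2)] is_adjoint_compose
        star_subalgebraD(4)[OF bo bounded[OF AB(1)] bounded[OF AB(2)]]
      by (fastforce simp: periodic_ops_def)
  qed
  have scale: "cscale_op c A \<in> periodic_ops N" if A: "A \<in> periodic_ops N" for A c
  proof -
    obtain j where j: "sn_dvd j N" "A o\<^sub>L shift (int j) = shift (int j) o\<^sub>L A"
      using A by (auto simp: periodic_ops_def)
    have "A (shift (int j) x) = shift (int j) (A x)" for x
      using j(2) by (metis blinfun_compose.rep_eq comp_apply)
    then have "cscale_op c A o\<^sub>L shift (int j) = shift (int j) o\<^sub>L cscale_op c A"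
      by (intro blinfun_eqI ell2_eqI) simp
    then show ?thesis
      using j(1) adj[OF A] is_adjoint_cscale star_subalgebraD(3)[OF bo bounded[OF A]]
      by (fastforce simp: periodic_ops_def)
  qed
  have adjoint: "B \<in> periodic_ops N" if A: "A \<in> periodic_ops N" and AB: "is_adjoint A B" for A B
  proof -
    obtain j where j: "sn_dvd j N" "A o\<^sub>L shift (int j) = shift (int j) o\<^sub>L A"
      using A by (auto simp: periodic_ops_def)
    \<comment> \<open>Taking adjoints of the commutation relation of A shows that B commutes with
      V^(-j). Multiplying by V^j on both sides then turns this into commutation with V^j.\<close>
    have "shift (- int j) o\<^sub>L B = B o\<^sub>L shift (- int j)"
      using is_adjoint_unique[of "A o\<^sub>L shift (int j)"]
        is_adjoint_compose[OF AB is_adjoint_shift] is_adjoint_compose[OF is_adjoint_shift AB]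
      by (metis j(2))
    then have "shift (int j) o\<^sub>L (shift (- int j) o\<^sub>L B) o\<^sub>L shift (int j) =
        shift (int j) o\<^sub>L (B o\<^sub>L shift (- int j)) o\<^sub>L shift (int j)"
      by simp
    moreover have "shift (int j) o\<^sub>L (shift (- int j) o\<^sub>L B) = B"
      by (intro blinfun_eqI ell2_eqI) simp
    moreover have "shift (int j) o\<^sub>L (B o\<^sub>L shift (- int j)) o\<^sub>L shift (int j) = shift (int j) o\<^sub>L B"
      by (simp add: blinfun_compose_assoc shift_add[symmetric] shift_0) (rule blinfun_eqI, simp)
    ultimately have "B o\<^sub>L shift (int j) = shift (int j) o\<^sub>L B" by simp
    then show ?thesis
      using j(1) is_adjoint_bounded_ops[OF AB] is_adjoint_sym[OF AB]
      by (auto simp: periodic_ops_def)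
  qed
  have "cscale_op 0 (shift 1) \<in> periodic_ops N"
    by (rule scale[OF shift_1_in_periodic_ops])
  moreover have "cscale_op 0 (shift 1) = 0"
    by (rule blinfun_eqI, rule ell2_eqI) simp
  ultimately have "0 \<in> periodic_ops N" by simp
  then show ?thesis
    unfolding star_subalgebra_def
    by (intro conjI ballI allI impI subsetI) (assumption | rule add comp scale bounded | rule adjoint)+
qed

section \<open>Norm closures of star subalgebras\<close>

lemma norm_cscale_op_le: "norm (cscale_op c A) \<le> cmod c * norm A"
proof (rule norm_blinfun_bound)
  show "norm (cscale_op c A x) \<le> cmod c * norm A * norm x" for x
    using norm_blinfun[of A x] by (simp add: norm_cscale mult.assoc mult_left_mono)
qed simp

lemma bounded_linear_cscale_op: "bounded_linear (cscale_op c)"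
  by (rule bounded_linear_intro[where K = "cmod c"])
    (auto intro!: blinfun_eqI ell2_eqI simp: norm_cscale_op_le mult.commute blinfun.add_left
      blinfun.scaleR_left algebra_simps)

text \<open>The algebraic operations are continuous. For adjoints, if C in S is close to A, then its
  adjoint D is equally close to the adjoint B of A, because adjunction does not increase the norm of
  C - A.\<close>

lemma cstar_subalgebra_closure:
  assumes S: "star_subalgebra S" and adj: "\<And>A. A \<in> S \<Longrightarrow> \<exists>B. is_adjoint A B"
  shows "cstar_subalgebra (closure S)"
proof -
  have seq: "\<exists>X. (\<forall>n. X n \<in> S) \<and> X \<longlonglongrightarrow> A" if "A \<in> closure S" for A
    using that by (simp add: closure_sequential)
  have lim: "A \<in> closure S" if "\<And>n. X n \<in> S" "X \<longlonglongrightarrow> A" for X A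
    using that closure_sequential by blast
  have "closed bounded_ops"
    using cstar_subalgebra_bounded_ops by (simp add: cstar_subalgebra_def)
  then have "closure S \<subseteq> bounded_ops"
    using S by (intro closure_minimal) (auto simp: star_subalgebra_def)
  moreover have "0 \<in> closure S"
    using S closure_subset by (auto simp: star_subalgebra_def)
  moreover have "A + B \<in> closure S" "A o\<^sub>L B \<in> closure S"
    if AB: "A \<in> closure S" "B \<in> closure S" for A B
  proof -
    obtain X Y where X: "\<And>n. X n \<in> S" "X \<longlonglongrightarrow> A" and Y: "\<And>n. Y n \<in> S" "Y \<longlonglongrightarrow> B"
      using seq AB by meson
    show "A + B \<in> closure S"
      using star_subalgebraD(2)[OF S X(1) Y(1)] tendsto_add[OF X(2) Y(2)] by (rule lim)
    show "A o\<^sub>L B \<in> closure S"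
      using star_subalgebraD(4)[OF S X(1) Y(1)]
        bounded_bilinear.tendsto[OF bounded_bilinear_blinfun_compose X(2) Y(2)] by (rule lim)
  qed
  moreover have "cscale_op c A \<in> closure S" if A: "A \<in> closure S" for A c
  proof -
    obtain X where X: "\<And>n. X n \<in> S" "X \<longlonglongrightarrow> A" using seq A by meson
    show ?thesis
      using star_subalgebraD(3)[OF S X(1)] bounded_linear.tendsto[OF bounded_linear_cscale_op X(2)]
      by (rule lim)
  qed
  moreover have "B \<in> closure S" if A: "A \<in> closure S" and AB: "is_adjoint A B" for A B
    unfolding closure_approachable
  proof (intro allI impI)
    fix e :: real
    assume "e > 0"
    then obtain C where C: "C \<in> S" "dist C A < e"
      using A by (auto simp: closure_approachable)
    obtain D where D: "is_adjoint C D" using adj C(1) by blast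
    have "D \<in> S" using star_subalgebraD(5)[OF S C(1) D] .
    moreover have "dist D B < e"
      using norm_adjoint_le[OF is_adjoint_diff[OF D AB]] C(2) by (simp add: dist_norm)
    ultimately show "\<exists>D\<in>S. dist D B < e" by blast
  qed
  ultimately show ?thesis
    unfolding cstar_subalgebra_def star_subalgebra_def by auto
qed

lemma diag_alg_subset_periodic_ops: "diag_alg N \<subseteq> periodic_ops N"
proof
  fix A
  assume A: "A \<in> diag_alg N"
  then obtain b j where b: "A = diag_op b" "bounded (range b)" "sn_dvd j N" "\<And>l. b (l + int j) = b l"
    by (rule bounded_diag_algE) blast
  have "b (k - int j) = b k" for k using b(4)[of "k - int j"] by simp
  then have "A o\<^sub>L shift (int j) = shift (int j) o\<^sub>L A"
    using b(2) by (intro blinfun_eqI ell2_eqI) (simp add: b(1))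
  then show "A \<in> periodic_ops N"
    using A diag_alg_bounded_ops b(3) is_adjoint_diag_op[OF b(2)] b(1)
    by (auto simp: periodic_ops_def)
qed

text \<open>The closure is a C*-algebra containing V, which commutes with itself, and every periodic
  diagonal; minimality of \<open>BD N\<close> gives the inclusion.\<close>

lemma BD_subset_closure_periodic_ops: "BD N \<subseteq> closure (periodic_ops N)"
proof -
  have "cstar_subalgebra (closure (periodic_ops N))"
    by (rule cstar_subalgebra_closure[OF star_subalgebra_periodic_ops]) (simp add: periodic_ops_def)
  moreover have "{shift 1} \<union> diag_alg N \<subseteq> closure (periodic_ops N)"
    using diag_alg_subset_periodic_ops shift_1_in_periodic_ops closure_subset by blast
  ultimately show ?thesis
    unfolding BD_def by (intro hull_minimal)
qed

text \<open>This is the m-th diagonal of the matrix, indexed by the column l, so that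
  \<open>shift m o\<^sub>L diag_op (diag_coeff m A)\<close> has exactly these entries on that
  diagonal and zeros elsewhere.\<close>

definition diag_coeff :: "int \<Rightarrow> ell2_op \<Rightarrow> int \<Rightarrow> complex" where
  "diag_coeff m A l = coord (A (basis_vec l)) (l + m)"

lemma bounded_diag_coeff: "bounded (range (diag_coeff m A))"
  using cmod_coord_basis_le_norm by (auto simp: bounded_iff diag_coeff_def)

lemma norm_diag_op_diff_le:
  assumes "bounded (range f)" "bounded (range g)" "C \<ge> 0" "\<And>l. cmod (f l - g l) \<le> C"
  shows "norm (diag_op f - diag_op g) \<le> C"
proof (rule norm_blinfun_bound[OF assms(3)])
  show "norm ((diag_op f - diag_op g) x) \<le> C * norm x" for x
  proof (rule norm_ell2_le[OF _ assms(3)])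
    fix k
    have "coord ((diag_op f - diag_op g) x) k = (f k - g k) * coord x k"
      using assms(1,2) by (simp add: blinfun.diff_left algebra_simps)
    then show "cmod (coord ((diag_op f - diag_op g) x) k) \<le> C * cmod (coord x k)"
      using assms(4)[of k] by (simp add: norm_mult mult_right_mono)
  qed
qed

text \<open>The main diagonal of a periodic operator is a periodic sequence, and every entry of S -
  A is bounded by its norm. Approximating A by periodic operators S thus approximates its diagonal
  by members of \<open>diag_alg N\<close>.\<close>

lemma diag_coeff_0_in_diag_closure:
  assumes "A \<in> BD N"
  shows "diag_op (diag_coeff 0 A) \<in> diag_closure N"
  unfolding diag_closure_def closure_approachable
proof (intro allI impI)
  fix e :: real
  assume "e > 0"
  then obtain S where S: "S \<in> periodic_ops N" "dist S A < e"
    using assms BD_subset_closure_periodic_ops[of N] closure_approachable[of A "periodic_ops N"]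
    by blast
  obtain j where j: "sn_dvd j N" "S o\<^sub>L shift (int j) = shift (int j) o\<^sub>L S"
    using S(1) by (auto simp: periodic_ops_def)
  have "S (shift (int j) x) = shift (int j) (S x)" for x
    using j(2) by (metis blinfun_compose.rep_eq comp_apply)
  then have "diag_coeff 0 S (l + int j) = diag_coeff 0 S l" for l
    by (simp add: diag_coeff_def shift_basis_vec[symmetric])
  then have "diag_op (diag_coeff 0 S) \<in> diag_alg N"
    using j(1) by (auto simp: diag_alg_def)
  moreover have "norm (diag_op (diag_coeff 0 S) - diag_op (diag_coeff 0 A)) \<le> norm (S - A)"
  proof (rule norm_diag_op_diff_le[OF bounded_diag_coeff bounded_diag_coeff norm_ge_zero])
    show "cmod (diag_coeff 0 S l - diag_coeff 0 A l) \<le> norm (S - A)" for l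
      using cmod_coord_basis_le_norm[of "S - A" l l] by (simp add: diag_coeff_def blinfun.diff_left)
  qed
  ultimately show "\<exists>D\<in>diag_alg N. dist D (diag_op (diag_coeff 0 A)) < e"
    using S(2) unfolding dist_norm by (meson le_less_trans)
qed

text \<open>Multiplication by V^(-m) moves the m-th diagonal to the main one and stays inside
  \<open>BD N\<close>.\<close>

lemma diag_coeff_in_diag_closure:
  assumes "A \<in> BD N"
  shows "diag_op (diag_coeff m A) \<in> diag_closure N"
proof -
  have "shift (- m) o\<^sub>L A \<in> BD N"
    using star_subalgebraD(4)[OF star_subalgebra_BD shift_in_BD assms] .
  moreover have "diag_coeff 0 (shift (- m) o\<^sub>L A) = diag_coeff m A"
    by (rule ext) (simp add: diag_coeff_def)
  ultimately show ?thesis using diag_coeff_0_in_diag_closure by metis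
qed

section \<open>Weighted shifts and commutators\<close>

lemma finite_vecs_add: "x \<in> finite_vecs \<Longrightarrow> y \<in> finite_vecs \<Longrightarrow> x + y \<in> finite_vecs"
  unfolding finite_vecs_iff
  by (rule finite_subset[of _ "{l. coord x l \<noteq> 0} \<union> {l. coord y l \<noteq> 0}"]) auto

lemma finite_vecs_cscale: "x \<in> finite_vecs \<Longrightarrow> c *\<^sub>c x \<in> finite_vecs"
  unfolding finite_vecs_iff by (rule finite_subset[of _ "{l. coord x l \<noteq> 0}"]) auto

lemma finite_vecs_shift: "x \<in> finite_vecs \<Longrightarrow> shift n x \<in> finite_vecs"
  unfolding finite_vecs_iff
  by (rule finite_subset[of _ "(\<lambda>l. l + n) ` {l. coord x l \<noteq> 0}"])
    (force simp: image_iff intro: exI[of _ "_ - n"])+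

lemma finite_vecs_diag_op: "bounded (range b) \<Longrightarrow> x \<in> finite_vecs \<Longrightarrow> diag_op b x \<in> finite_vecs"
  unfolding finite_vecs_iff by (rule finite_subset[of _ "{l. coord x l \<noteq> 0}"]) auto

lemma finite_vecs_basis_vec: "basis_vec l \<in> finite_vecs"
  unfolding finite_vecs_iff by (simp add: coord_basis_vec)

lemma BD_alg_finite_vecs: "A \<in> BD_alg N \<Longrightarrow> x \<in> finite_vecs \<Longrightarrow> A x \<in> finite_vecs"
proof (induction arbitrary: x rule: BD_alg_induct)
  case (diag A)
  then show ?case by (metis bounded_diag_algE finite_vecs_diag_op)
qed (auto simp: blinfun.add_left finite_vecs_shift finite_vecs_add finite_vecs_cscale)

text \<open>A map on vectors instead of an \<open>ell2_op\<close>, since \<eta> may be unbounded. As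
  \<open>diag_map\<close> is cut off to zero outside its domain, linearity is claimed on
  \<open>finite_vecs\<close> only, which \<open>BD_alg N\<close> preserves.\<close>

definition weighted_shift :: "int \<Rightarrow> (int \<Rightarrow> complex) \<Rightarrow> ell2 \<Rightarrow> ell2" where
  "weighted_shift n \<eta> x = shift n (diag_map \<eta> x)"

lemma commutator_weighted_shift:
  "commutator n \<eta> A x = weighted_shift n \<eta> (A x) - A (weighted_shift n \<eta> x)"
  by (simp add: commutator_def weighted_shift_def)

lemma coord_weighted_shift:
  "x \<in> finite_vecs \<Longrightarrow> coord (weighted_shift n \<eta> x) k = \<eta> (k - n) * coord x (k - n)"
  by (simp add: weighted_shift_def coord_diag_map_finite)

lemma weighted_shift_add:
  "x \<in> finite_vecs \<Longrightarrow> y \<in> finite_vecs \<Longrightarrow>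
    weighted_shift n \<eta> (x + y) = weighted_shift n \<eta> x + weighted_shift n \<eta> y"
  by (rule ell2_eqI) (simp add: coord_weighted_shift finite_vecs_add distrib_left)

lemma weighted_shift_cscale:
  "x \<in> finite_vecs \<Longrightarrow> weighted_shift n \<eta> (c *\<^sub>c x) = c *\<^sub>c weighted_shift n \<eta> x"
  by (rule ell2_eqI) (simp add: coord_weighted_shift finite_vecs_cscale mult.left_commute)

section \<open>Algebraic rules for commutators with a weighted shift\<close>

lemma bounded_extension_commutator_add:
  assumes "A \<in> BD_alg N" "B \<in> BD_alg N"
    "bounded_extension (commutator n \<eta> A) D" "bounded_extension (commutator n \<eta> B) E"
  shows "bounded_extension (commutator n \<eta> (A + B)) (D + E)"
  using assms
  by (simp add: bounded_extension_def commutator_weighted_shift blinfun.add_left weighted_shift_add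
      BD_alg_finite_vecs)

lemma bounded_extension_commutator_cscale:
  assumes "A \<in> BD_alg N" "bounded_extension (commutator n \<eta> A) D"
  shows "bounded_extension (commutator n \<eta> (cscale_op c A)) (cscale_op c D)"
  using assms
  by (auto simp: bounded_extension_def commutator_weighted_shift weighted_shift_cscale
      BD_alg_finite_vecs right_diff_distrib intro!: ell2_eqI)

text \<open>Leibniz rule [M, AB] = [M, A]B + A[M, B]; the extension D may be replaced by the
  commutator at Bx because B preserves \<open>finite_vecs\<close>.\<close>

lemma bounded_extension_commutator_compose:
  assumes "A \<in> BD_alg N" "B \<in> BD_alg N"
    "bounded_extension (commutator n \<eta> A) D" "bounded_extension (commutator n \<eta> B) E"
  shows "bounded_extension (commutator n \<eta> (A o\<^sub>L B)) ((D o\<^sub>L B) + (A o\<^sub>L E))"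
  using assms
  by (simp add: bounded_extension_def commutator_weighted_shift blinfun.add_left blinfun.diff_right
      BD_alg_finite_vecs)

lemma bounded_extension_unique:
  assumes "bounded_extension T A" "bounded_extension T B"
  shows "A = B"
  by (rule blinfun_eqI_finite_vecs) (use assms in \<open>simp add: bounded_extension_def\<close>)

text \<open>With M = V^n \<eta>(L), the commutator [M, V] sends E_l to (\<eta>(l+1) - \<eta>(l))
  E_(l+n+1), so only the differences of \<eta> have to be bounded. The second formula is [M, V^(-1)]
  = - V^(-1) [M, V] V^(-1).\<close>

lemma bounded_extension_commutator_shift:
  assumes \<beta>: "bounded (range \<beta>)" "\<And>l. \<eta> (l + 1) - \<eta> l = \<beta> l"
  shows "bounded_extension (commutator n \<eta> (shift 1)) (shift (n + 1) o\<^sub>L diag_op \<beta>)"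
    and "bounded_extension (commutator n \<eta> (shift (- 1)))
      (cscale_op (- 1) (shift n o\<^sub>L diag_op \<beta> o\<^sub>L shift (- 1)))"
proof -
  have 1: "\<beta> (k - n - 1) = \<eta> (k - n) - \<eta> (k - n - 1)" for k
    using \<beta>(2)[of "k - n - 1"] by simp
  have 2: "\<beta> (k - n) = \<eta> (k - n + 1) - \<eta> (k - n)" for k
    using \<beta>(2)[of "k - n"] by simp
  \<comment> \<open>These equations fix a common form of the indices; \<open>diff_diff_add\<close>
    would regroup \<open>k - n - 1\<close> and is removed from the simp set.\<close>
  have index: "k - (n + 1) = k - n - 1" "k - 1 - n = k - n - 1" "k + 1 - n = k - n + 1" for k
    by simp_all
  show "bounded_extension (commutator n \<eta> (shift 1)) (shift (n + 1) o\<^sub>L diag_op \<beta>)"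
    unfolding bounded_extension_def commutator_weighted_shift
    by (intro ballI ell2_eqI)
      (simp add: \<beta>(1) coord_weighted_shift finite_vecs_shift index 1 left_diff_distrib del: diff_diff_add)
  show "bounded_extension (commutator n \<eta> (shift (- 1)))
      (cscale_op (- 1) (shift n o\<^sub>L diag_op \<beta> o\<^sub>L shift (- 1)))"
    unfolding bounded_extension_def commutator_weighted_shift
    by (intro ballI ell2_eqI)
      (simp add: \<beta>(1) coord_weighted_shift finite_vecs_shift index 2 left_diff_distrib del: diff_diff_add)
qed

text \<open>On E_l the two products are \<eta>(l) b(l) E_(l+n) and \<eta>(l) b(l+n) E_(l+n).\<close>

lemma bounded_extension_commutator_diag_op:
  assumes "bounded (range b)" "bounded (range \<gamma>)" "\<And>l. \<eta> l * (b l - b (l + n)) = \<gamma> l"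
  shows "bounded_extension (commutator n \<eta> (diag_op b)) (shift n o\<^sub>L diag_op \<gamma>)"
proof -
  have "\<gamma> (k - n) = \<eta> (k - n) * (b (k - n) - b k)" for k
    using assms(3)[of "k - n"] by simp
  then show ?thesis
    using assms(1,2) unfolding bounded_extension_def commutator_weighted_shift
    by (intro ballI ell2_eqI)
      (simp add: coord_weighted_shift finite_vecs_diag_op left_diff_distrib right_diff_distrib)
qed

text \<open>The values of f are diagonal matrix entries of the bounded extension, so f is bounded by
  its norm, and the extension must then be \<open>diag_op f\<close>.\<close>

lemma in_diag_closure_iff:
  "in_diag_closure N f \<longleftrightarrow> bounded (range f) \<and> diag_op f \<in> diag_closure N"
proof
  assume "in_diag_closure N f"
  then obtain A where A: "A \<in> diag_closure N" "bounded_extension (diag_map f) A"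
    by (auto simp: in_diag_closure_def)
  have "coord (A (basis_vec l)) l = f l" for l
    using A(2) finite_vecs_basis_vec[of l]
    by (simp add: bounded_extension_def coord_diag_map_finite coord_basis_vec)
  then have bdd: "bounded (range f)"
    using cmod_coord_basis_le_norm[of A] by (auto simp: bounded_iff) metis
  moreover have "A = diag_op f"
    using bounded_extension_unique[OF A(2)] by (simp add: bounded_extension_def diag_op_apply[OF bdd])
  ultimately show "bounded (range f) \<and> diag_op f \<in> diag_closure N" using A(1) by simp
next
  assume "bounded (range f) \<and> diag_op f \<in> diag_closure N"
  then show "in_diag_closure N f"
    by (auto simp: in_diag_closure_def bounded_extension_def diag_op_apply intro!: bexI[of _ "diag_op f"])
qed

lemma periodic_dvd:
  fixes b :: "int \<Rightarrow> 'a"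
  assumes b: "\<And>l. b (l + j) = b l" and "j dvd m"
  shows "b (l + m) = b l"
proof -
  obtain q where q: "m = j * q" using assms(2) by (rule dvdE)
  have "b (l + j * q) = b l"
  proof (induction q rule: int_induct[of _ 0])
    case base
    show ?case by simp
  next
    case (step1 i)
    then show ?case using b[of "l + j * i"] by (simp add: algebra_simps)
  next
    case (step2 i)
    then show ?case using b[of "l + j * (i - 1)"] by (simp add: algebra_simps)
  qed
  then show ?thesis by (simp add: q)
qed

section \<open>Commutators of admissible sequences have values in the Bunce-Deddens algebra\<close>

lemma admissible_iff:
  "admissible N n \<eta> \<longleftrightarrow>
    (if \<exists>j. sn_dvd j N \<and> \<not> int j dvd n then in_diag_closure N \<eta>
     else in_diag_closure N (\<lambda>l. \<eta> (l + 1) - \<eta> l))"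
  unfolding admissible_def ex_sn_dvd_not_dvd_iff ..

text \<open>If some divisor of N does not divide n, then V^n \<eta>(L) itself lies in
  \<open>BD N\<close> and the commutator is an ordinary one. Otherwise n is a period of every
  periodic diagonal, so commutators with diagonals vanish, those with V and its inverse involve only
  differences of \<eta>, and induction over the generators finishes.\<close>

lemma commutator_bounded_extension_ex:
  assumes adm: "admissible N n \<eta>" and A: "A \<in> BD_alg N"
  shows "\<exists>D\<in>BD N. bounded_extension (commutator n \<eta> A) D"
proof (cases "\<exists>j. sn_dvd j N \<and> \<not> int j dvd n")
  case True
  then have \<eta>: "bounded (range \<eta>)" "diag_op \<eta> \<in> diag_closure N"
    using adm by (auto simp: admissible_iff in_diag_closure_iff)
  define M where "M = shift n o\<^sub>L diag_op \<eta>"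
  have "M \<in> BD N"
    unfolding M_def using \<eta>(2) diag_closure_subset_BD
    by (intro star_subalgebraD(4)[OF star_subalgebra_BD] shift_in_BD) auto
  then have "(M o\<^sub>L A) - (A o\<^sub>L M) \<in> BD N"
    using A BD_alg_subset_BD[of N]
    by (intro star_subalgebra_diff star_subalgebraD(4) star_subalgebra_BD) auto
  moreover have "bounded_extension (commutator n \<eta> A) ((M o\<^sub>L A) - (A o\<^sub>L M))"
    by (simp add: bounded_extension_def commutator_def M_def diag_op_apply[OF \<eta>(1)] blinfun.diff_left)
  ultimately show ?thesis by blast
next
  case False
  define \<beta> where "\<beta> l = \<eta> (l + 1) - \<eta> l" for l
  have \<beta>: "bounded (range \<beta>)" "diag_op \<beta> \<in> BD N"
    using adm False diag_closure_subset_BD[of N]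
    by (auto simp: admissible_iff in_diag_closure_iff \<beta>_def[abs_def])
  note BD = star_subalgebraD[OF star_subalgebra_BD[of N]]
  note comm = bounded_extension_commutator_shift[of \<beta> \<eta> n, OF \<beta>(1) \<beta>_def[symmetric]]
  show ?thesis
    using A
  proof (induction rule: BD_alg_induct)
    case shift
    show ?case using comm(1) BD(4)[OF shift_in_BD \<beta>(2)] by blast
  next
    case shift_inv
    show ?case using comm(2) BD(3)[OF BD(4)[OF BD(4)[OF shift_in_BD \<beta>(2)] shift_in_BD]] by blast
  next
    case (diag A)
    then obtain b j where b: "A = diag_op b" "bounded (range b)" "sn_dvd j N" "\<And>l. b (l + int j) = b l"
      by (rule bounded_diag_algE) blast
    have "b (l + n) = b l" for l
      using b(3) False by (intro periodic_dvd[of b "int j", OF b(4)]) auto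
    then have "bounded_extension (commutator n \<eta> A) (shift n o\<^sub>L diag_op (\<lambda>_. 0))"
      unfolding b(1) by (intro bounded_extension_commutator_diag_op b(2)) (auto simp: bounded_iff)
    moreover have "diag_op (\<lambda>_. 0) \<in> BD N"
      using sn_dvd_1[of N] by (intro diag_alg_subset_BD[THEN subsetD]) (auto simp: diag_alg_def)
    ultimately show ?case using BD(4)[OF shift_in_BD] by blast
  next
    case (add A B)
    then obtain D E where "D \<in> BD N" "bounded_extension (commutator n \<eta> A) D"
      "E \<in> BD N" "bounded_extension (commutator n \<eta> B) E" by blast
    then show ?case using bounded_extension_commutator_add[OF add(1,2)] BD(2)[of D E] by blast
  next
    case (scale c A)
    then obtain D where "D \<in> BD N" "bounded_extension (commutator n \<eta> A) D" by blast
    then show ?case using bounded_extension_commutator_cscale[OF scale(1)] BD(3)[of D c] by blast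
  next
    case (comp A B)
    then obtain D E where DE: "D \<in> BD N" "bounded_extension (commutator n \<eta> A) D"
      "E \<in> BD N" "bounded_extension (commutator n \<eta> B) E" by blast
    have "A \<in> BD N" "B \<in> BD N" using comp(1,2) BD_alg_subset_BD[of N] by auto
    then have "(D o\<^sub>L B) + (A o\<^sub>L E) \<in> BD N" using DE(1,3) BD(2,4) by simp
    then show ?case using bounded_extension_commutator_compose[OF comp(1,2) DE(2,4)] by blast
  qed
qed

section \<open>The gauge action\<close>

lemma rho_apply:
  "coord (rho \<theta> A x) k = exp (\<i> * \<theta> * k) * coord (A (diag_op (\<lambda>l. exp (- \<i> * \<theta> * l)) x)) k"
  unfolding rho_def by (simp add: bounded_range_phase)

lemma coord_rho_basis:
  assumes "A \<in> bounded_ops"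
  shows "coord (rho \<theta> A (basis_vec l)) k = exp (\<i> * \<theta> * (k - l)) * coord (A (basis_vec l)) k"
proof -
  have "exp (\<i> * \<theta> * k) * exp (- \<i> * \<theta> * l) = exp (\<i> * \<theta> * (k - l))"
    by (simp add: mult_exp_exp algebra_simps)
  moreover have "A (c *\<^sub>c x) = c *\<^sub>c A x" for c x
    using assms by (simp add: bounded_ops_def)
  ultimately show ?thesis
    unfolding rho_apply diag_op_basis_vec[OF bounded_range_phase(2)] by simp
qed

lemma rho_compose: "rho \<theta> (A o\<^sub>L B) = rho \<theta> A o\<^sub>L rho \<theta> B"
proof -
  have "exp (- \<i> * \<theta> * l) * (exp (\<i> * \<theta> * l) * z) = z" for l :: int and z :: complex
    by (simp add: mult.assoc[symmetric] mult_exp_exp)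
  then have cancel: "diag_op (\<lambda>l. exp (- \<i> * \<theta> * l)) (diag_op (\<lambda>l. exp (\<i> * \<theta> * l)) x) = x" for x
    by (intro ell2_eqI) (simp only: coord_diag_op bounded_range_phase)
  show ?thesis
    unfolding rho_def by (rule blinfun_eqI) (use cancel in simp)
qed

lemma rho_add: "rho \<theta> (A + B) = rho \<theta> A + rho \<theta> B"
  by (rule blinfun_eqI, rule ell2_eqI) (simp add: rho_apply blinfun.add_left distrib_left)

lemma rho_cscale: "rho \<theta> (cscale_op c A) = cscale_op c (rho \<theta> A)"
  by (rule blinfun_eqI, rule ell2_eqI) (simp add: rho_apply mult.left_commute)

lemma rho_bounded_ops:
  assumes "A \<in> bounded_ops"
  shows "rho \<theta> A \<in> bounded_ops"
proof -
  have "diag_op b (c *\<^sub>c x) = c *\<^sub>c diag_op b x" if "bounded (range b)" for b c x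
    using that by (intro ell2_eqI) (simp add: mult.left_commute)
  then show ?thesis
    using assms bounded_range_phase unfolding rho_def bounded_ops_def by simp
qed

lemma rho_shift: "rho \<theta> (shift n) = cscale_op (exp (\<i> * \<theta> * n)) (shift n)"
  by (rule bounded_ops_eqI_basis)
    (auto simp: rho_bounded_ops shift_bounded_ops coord_rho_basis shift_basis_vec coord_basis_vec
      star_subalgebraD(3)[OF cstar_subalgebra_bounded_ops[unfolded cstar_subalgebra_def, THEN conjunct1]]
      intro!: ell2_eqI)

lemma rho_diag_op: "bounded (range b) \<Longrightarrow> rho \<theta> (diag_op b) = diag_op b"
proof -
  assume b: "bounded (range b)"
  have "exp (\<i> * \<theta> * l) * (z * (exp (- \<i> * \<theta> * l) * w)) = z * w" for l :: int and z w :: complex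
    by (simp add: mult.left_commute[of _ z] mult.assoc[symmetric] mult_exp_exp)
  then show "rho \<theta> (diag_op b) = diag_op b"
    using b by (intro blinfun_eqI ell2_eqI) (simp only: rho_apply coord_diag_op bounded_range_phase)
qed

lemma rho_BD_alg: "A \<in> BD_alg N \<Longrightarrow> rho \<theta> A \<in> BD_alg N"
proof (induction rule: BD_alg_induct)
  case (diag A)
  then show ?case
    by (metis bounded_diag_algE rho_diag_op diag_alg_subset_BD_alg subsetD)
qed (auto simp: rho_shift rho_add rho_cscale rho_compose shift_in_BD_alg
    intro: star_subalgebraD[OF star_subalgebra_BD_alg])

text \<open>The angle pi/\<bar>m\<bar> lies below 2 pi because \<bar>m\<bar> \<ge> 1. The phase -1
  will turn covariance into an equation x = -x for matrix entries.\<close>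

lemma exp_half_turn:
  fixes m :: int
  assumes "m \<noteq> 0"
  obtains \<theta> where "\<theta> \<in> {0..<2 * pi}" "exp (\<i> * complex_of_real \<theta> * of_int m) = - 1"
proof
  define \<theta> where "\<theta> = pi / real_of_int \<bar>m\<bar>"
  have "real_of_int \<bar>m\<bar> \<ge> 1" using assms by linarith
  then have "\<theta> \<le> pi" by (simp add: \<theta>_def divide_le_eq)
  moreover have "0 \<le> \<theta>" by (simp add: \<theta>_def)
  ultimately show "\<theta> \<in> {0..<2 * pi}" using pi_gt_zero unfolding atLeastLessThan_iff by linarith
  have "\<theta> * real_of_int m = pi \<or> \<theta> * real_of_int m = - pi"
    using assms by (auto simp: \<theta>_def abs_if)
  moreover have "exp (\<i> * complex_of_real \<theta> * of_int m) = cis (\<theta> * real_of_int m)"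
    by (simp add: cis_conv_exp mult.assoc)
  ultimately show "exp (\<i> * complex_of_real \<theta> * of_int m) = - 1"
    by (auto simp: cis.ctr complex_eq_iff)
qed

text \<open>Conjugation multiplies the entry in row k and column l by exp(-i \<theta> (k - l)),
  whereas covariance demands the factor exp(-i m \<theta>). These conflict for a suitable \<theta>
  unless k = l + m, so only the m-th diagonal survives.\<close>

lemma covariant_eq_weighted_shift:
  assumes A: "A \<in> bounded_ops"
    and cov: "\<And>\<theta>. \<theta> \<in> {0..<2 * pi} \<Longrightarrow> rho (- \<theta>) A = cscale_op (exp (- \<i> * m * \<theta>)) A"
  shows "A = shift m o\<^sub>L diag_op (diag_coeff m A)"
proof (rule bounded_ops_eqI_basis[OF A])
  show "shift m o\<^sub>L diag_op (diag_coeff m A) \<in> bounded_ops"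
    by (auto simp: bounded_ops_def bounded_diag_coeff mult.left_commute intro!: ell2_eqI)
  fix l
  show "A (basis_vec l) = (shift m o\<^sub>L diag_op (diag_coeff m A)) (basis_vec l)"
  proof (rule ell2_eqI)
    fix k
    have "coord (A (basis_vec l)) k = 0" if "k \<noteq> l + m"
    proof -
      have "l + m - k \<noteq> 0" using that by simp
      then obtain \<theta> where \<theta>: "\<theta> \<in> {0..<2 * pi}"
          "exp (\<i> * complex_of_real \<theta> * of_int (l + m - k)) = - 1"
        by (rule exp_half_turn) blast
      have "coord (rho (- \<theta>) A (basis_vec l)) k =
          exp (- \<i> * m * \<theta>) * coord (A (basis_vec l)) k"
        using cov[OF \<theta>(1)] by simp
      then have "exp (\<i> * complex_of_real (- \<theta>) * of_int (k - l)) * coord (A (basis_vec l)) k =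
          exp (- \<i> * m * \<theta>) * coord (A (basis_vec l)) k"
        by (simp only: coord_rho_basis[OF A] of_int_diff)
      then have "exp (\<i> * m * \<theta>) * exp (\<i> * complex_of_real (- \<theta>) * of_int (k - l)) *
            coord (A (basis_vec l)) k =
          exp (\<i> * m * \<theta>) * exp (- \<i> * m * \<theta>) * coord (A (basis_vec l)) k"
        by (simp only: mult.assoc)
      moreover have "exp (\<i> * m * \<theta>) * exp (\<i> * complex_of_real (- \<theta>) * of_int (k - l)) = - 1"
        unfolding \<theta>(2)[symmetric] mult_exp_exp by (simp add: algebra_simps)
      moreover have "exp (\<i> * m * \<theta>) * exp (- \<i> * m * \<theta>) = 1"
        by (simp add: mult_exp_exp)
      ultimately have "- coord (A (basis_vec l)) k = coord (A (basis_vec l)) k"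
        by (simp only: mult_minus_left mult_1)
      then show ?thesis by simp
    qed
    then show "coord (A (basis_vec l)) k =
        coord ((shift m o\<^sub>L diag_op (diag_coeff m A)) (basis_vec l)) k"
      using coord_diag_op[OF bounded_diag_coeff, of m A "basis_vec l" "k - m"]
      by (cases "k = l + m") (simp_all add: coord_basis_vec, simp add: diag_coeff_def)
  qed
qed

section \<open>Covariance of the commutator\<close>

lemma cscale_op_cscale_op: "cscale_op c (cscale_op d A) = cscale_op (c * d) A"
  by (rule blinfun_eqI, rule ell2_eqI) (simp add: mult.assoc)

lemma cscale_op_one: "cscale_op 1 A = A"
  by (rule blinfun_eqI, rule ell2_eqI) simp

text \<open>Formally, conjugation by -\<theta> multiplies M = V^n \<eta>(L) by exp(-i n \<theta>)
  and undoes \<open>rho \<theta>\<close> on b. As M may be unbounded, this is checked in coordinates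
  on \<open>finite_vecs\<close>.\<close>

lemma rho_minus_covariant:
  assumes b: "b \<in> BD_alg N" and D: "bounded_extension (commutator n \<eta> b) D"
    and D': "bounded_extension (commutator n \<eta> (rho \<theta> b)) D'"
  shows "rho (- \<theta>) D' = cscale_op (exp (- \<i> * n * \<theta>)) D"
proof (rule blinfun_eqI_finite_vecs, rule ell2_eqI)
  fix x k
  assume x: "x \<in> finite_vecs"
  define e where "e l = exp (\<i> * \<theta> * l)" for l :: int
  define e' where "e' l = exp (- \<i> * \<theta> * l)" for l :: int
  have ee': "e' l * e l = 1" "e l * e' l = 1" for l
    by (simp_all add: e_def e'_def mult_exp_exp)
  have e_diff: "e (l - n) = e l * e' n" "e' n = exp (- \<i> * n * \<theta>)" for l
    by (simp_all add: e_def e'_def mult_exp_exp algebra_simps)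
  have bdd: "bounded (range e)" "bounded (range e')"
    unfolding e_def[abs_def] e'_def[abs_def] by (rule bounded_range_phase)+
  have rho: "coord (rho \<theta> A y) l = e l * coord (A (diag_op e' y)) l" for A y l
    by (simp add: rho_apply e_def e'_def[abs_def])
  have rho_m: "coord (rho (- \<theta>) A y) l = e' l * coord (A (diag_op e y)) l" for A y l
    by (simp add: rho_apply e'_def e_def[abs_def])
  \<comment> \<open>\<open>rho (- \<theta>) D'\<close> first applies the phases e to x, so the
    extension D' has to be evaluated at this vector.\<close>
  let ?y = "diag_op e x"
  have y: "?y \<in> finite_vecs" using x bdd(1) by (rule finite_vecs_diag_op[rotated])
  have yx: "diag_op e' ?y = x"
    by (rule ell2_eqI) (simp add: bdd mult.assoc[symmetric] ee')
  have wy: "diag_op e' (weighted_shift n \<eta> ?y) = e' n *\<^sub>c weighted_shift n \<eta> x"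
  proof (rule ell2_eqI)
    fix l
    have "e' l * (\<eta> (l - n) * (e l * e' n * coord x (l - n))) =
        (e' l * e l) * (e' n * (\<eta> (l - n) * coord x (l - n)))"
      by (simp only: mult_ac)
    then show "coord (diag_op e' (weighted_shift n \<eta> ?y)) l = coord (e' n *\<^sub>c weighted_shift n \<eta> x) l"
      by (simp add: bdd coord_weighted_shift x y e_diff ee')
  qed
  have b_lin: "b (c *\<^sub>c z) = c *\<^sub>c b z" for c z
    using star_subalgebraD(1)[OF star_subalgebra_BD_alg b] by (simp add: bounded_ops_def)
  have bx: "b x \<in> finite_vecs" using BD_alg_finite_vecs[OF b x] .
  have by_fin: "rho \<theta> b ?y \<in> finite_vecs"
    using BD_alg_finite_vecs[OF rho_BD_alg[OF b] y] .
  have "coord (rho (- \<theta>) D' x) k = e' k * coord (commutator n \<eta> (rho \<theta> b) ?y) k"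
    using D' y by (simp add: rho_m bounded_extension_def)
  also have "\<dots> = e' k * (\<eta> (k - n) * (e k * e' n * coord (b x) (k - n)) -
      e k * (e' n * coord (b (weighted_shift n \<eta> x)) k))"
    by (simp add: commutator_weighted_shift coord_weighted_shift by_fin rho yx wy b_lin e_diff)
  also have "\<dots> = (e' k * e k) * (e' n * (\<eta> (k - n) * coord (b x) (k - n) -
      coord (b (weighted_shift n \<eta> x)) k))"
    by (simp only: right_diff_distrib mult_ac)
  also have "\<dots> = coord (cscale_op (exp (- \<i> * n * \<theta>)) D x) k"
    using D x by (simp add: ee' bounded_extension_def commutator_weighted_shift
        coord_weighted_shift bx e_diff(2))
  finally show "coord (rho (- \<theta>) D' x) k = coord (cscale_op (exp (- \<i> * n * \<theta>)) D x) k" .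
qed

text \<open>Uniqueness of bounded extensions transfers linearity, the Leibniz rule and covariance
  from commutators to \<delta>; admissibility places the values in \<open>BD N\<close>.\<close>

lemma covariant_derivation_of_commutator:
  assumes adm: "admissible N n \<eta>"
    and \<delta>: "\<And>a. a \<in> BD_alg N \<Longrightarrow> bounded_extension (commutator n \<eta> a) (\<delta> a)"
  shows "covariant_derivation N n \<delta>"
proof -
  note alg = star_subalgebraD[OF star_subalgebra_BD_alg[of N]]
  have "\<delta> a \<in> BD N" if a: "a \<in> BD_alg N" for a
    using commutator_bounded_extension_ex[OF adm a] bounded_extension_unique[OF \<delta>[OF a]] by blast
  moreover have "\<delta> (a + b) = \<delta> a + \<delta> b" if ab: "a \<in> BD_alg N" "b \<in> BD_alg N" for a b
    using bounded_extension_unique[OF \<delta>[OF alg(2)[OF ab]]]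
      bounded_extension_commutator_add[OF ab \<delta>[OF ab(1)] \<delta>[OF ab(2)]] by blast
  moreover have "\<delta> (cscale_op c a) = cscale_op c (\<delta> a)" if a: "a \<in> BD_alg N" for a c
    using bounded_extension_unique[OF \<delta>[OF alg(3)[OF a]]]
      bounded_extension_commutator_cscale[OF a \<delta>[OF a]] by blast
  moreover have "\<delta> (a o\<^sub>L b) = (\<delta> a o\<^sub>L b) + (a o\<^sub>L \<delta> b)"
    if ab: "a \<in> BD_alg N" "b \<in> BD_alg N" for a b
    using bounded_extension_unique[OF \<delta>[OF alg(4)[OF ab]]]
      bounded_extension_commutator_compose[OF ab \<delta>[OF ab(1)] \<delta>[OF ab(2)]] by blast
  moreover have "inv (rho \<theta>) (\<delta> (rho \<theta> b)) = cscale_op (exp (- \<i> * n * \<theta>)) (\<delta> b)"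
    if b: "b \<in> BD_alg N" for \<theta> b
    unfolding inv_rho using rho_minus_covariant[OF b \<delta>[OF b] \<delta>[OF rho_BD_alg[OF b]]] .
  ultimately show ?thesis
    unfolding covariant_derivation_def derivation_def by simp
qed

section \<open>Covariant derivations are commutators\<close>

lemma telescoping_primitive:
  fixes \<beta> :: "int \<Rightarrow> 'a::ab_group_add"
  obtains \<eta> where "\<And>l. \<eta> (l + 1) - \<eta> l = \<beta> l"
proof
  define \<eta> where "\<eta> l = (if l \<ge> 0 then sum \<beta> {0..<l} else - sum \<beta> {l..<0})" for l
  fix l
  show "\<eta> (l + 1) - \<eta> l = \<beta> l"
  proof (cases "l \<ge> 0")
    case True
    then have "{0..<l + 1} = insert l {0..<l}" by auto
    then show ?thesis using True by (simp add: \<eta>_def)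
  next
    case False
    then have "{l..<0} = insert l {l + 1..<0}" by auto
    \<comment> \<open>At l = -1 the successor 0 already belongs to the other branch of the
      definition, where the sum is empty.\<close>
    then show ?thesis using False by (cases "l = - 1") (simp_all add: \<eta>_def)
  qed
qed

text \<open>The character exp(2 pi i l/j) of the integers modulo j takes the value 1 only at
  multiples of j.\<close>

lemma periodic_character:
  fixes j :: nat and n :: int
  assumes j: "j > 0" and n: "\<not> int j dvd n"
  obtains c :: "int \<Rightarrow> complex" where
    "\<And>k l. c (k + l) = c k * c l" "c 0 = 1" "\<And>l. c (l + int j) = c l" "c n \<noteq> 1"
proof
  define c where "c l = cis (2 * pi * of_int l / of_nat j)" for l :: int
  show add: "c (k + l) = c k * c l" for k l
    by (simp add: c_def cis_mult add_divide_distrib distrib_left)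
  show "c 0 = 1" by (simp add: c_def)
  have "c (int j) = 1" using j by (simp add: c_def)
  then show "c (l + int j) = c l" for l by (simp add: add)
  show "c n \<noteq> 1"
  proof
    assume "c n = 1"
    then obtain q :: int where "2 * pi * of_int n / of_nat j = of_int (2 * q) * pi"
      unfolding c_def cis_conv_exp exp_eq_1 by auto
    then have "real_of_int n = of_int (int j * q)"
      using j by (simp add: field_simps)
    then have "n = int j * q" by (simp only: of_int_eq_iff)
    then show False using n by simp
  qed
qed

text \<open>An element of degree m under the gauge action is sent to one of degree n + m, hence to a
  single weighted shift. It is used with m = 1 for V and m = 0 for diagonals.\<close>

lemma covariant_derivation_form:
  assumes cov: "covariant_derivation N n \<delta>" and a: "a \<in> BD_alg N"
    and rho_a: "\<And>\<theta>. rho \<theta> a = cscale_op (exp (\<i> * \<theta> * m)) a"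
  shows "\<delta> a = shift (n + m) o\<^sub>L diag_op (diag_coeff (n + m) (\<delta> a))"
proof (rule covariant_eq_weighted_shift)
  have deriv: "derivation N \<delta>" using cov by (simp add: covariant_derivation_def)
  then show "\<delta> a \<in> bounded_ops"
    using a star_subalgebraD(1)[OF star_subalgebra_BD] by (auto simp: derivation_def)
  fix \<theta> :: real
  assume \<theta>: "\<theta> \<in> {0..<2 * pi}"
  have "cscale_op (exp (\<i> * \<theta> * m)) (rho (- \<theta>) (\<delta> a)) = rho (- \<theta>) (\<delta> (rho \<theta> a))"
    using deriv a by (simp add: rho_a derivation_def rho_cscale)
  also have "\<dots> = cscale_op (exp (- \<i> * n * \<theta>)) (\<delta> a)"
    using cov \<theta> a unfolding covariant_derivation_def inv_rho by blast
  finally have "cscale_op (exp (- \<i> * \<theta> * m)) (cscale_op (exp (\<i> * \<theta> * m)) (rho (- \<theta>) (\<delta> a))) =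
      cscale_op (exp (- \<i> * \<theta> * m)) (cscale_op (exp (- \<i> * n * \<theta>)) (\<delta> a))"
    by simp
  moreover have "exp (- \<i> * \<theta> * m) * exp (\<i> * \<theta> * m) = 1"
    "exp (- \<i> * \<theta> * m) * exp (- \<i> * n * \<theta>) = exp (- \<i> * of_int (n + m) * \<theta>)"
    by (simp_all add: mult_exp_exp algebra_simps)
  ultimately show "rho (- \<theta>) (\<delta> a) = cscale_op (exp (- \<i> * of_int (n + m) * \<theta>)) (\<delta> a)"
    by (simp only: cscale_op_cscale_op cscale_op_one)
qed

text \<open>Both sides satisfy the same algebraic rules, so agreement on the generators suffices;
  the value at V^(-1) is forced by the one at V.\<close>

lemma derivation_eq_commutator:
  assumes deriv: "derivation N \<delta>"
    and \<beta>: "bounded (range \<beta>)" "\<delta> (shift 1) = shift (n + 1) o\<^sub>L diag_op \<beta>"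
    and \<eta>: "\<And>l. \<eta> (l + 1) - \<eta> l = \<beta> l"
    and diag: "\<And>a. a \<in> diag_alg N \<Longrightarrow> bounded_extension (commutator n \<eta> a) (\<delta> a)"
    and a: "a \<in> BD_alg N"
  shows "bounded_extension (commutator n \<eta> a) (\<delta> a)"
proof -
  have deriv_add: "\<delta> (a + b) = \<delta> a + \<delta> b" if "a \<in> BD_alg N" "b \<in> BD_alg N" for a b
    using deriv that by (simp add: derivation_def)
  have deriv_scale: "\<delta> (cscale_op c a) = cscale_op c (\<delta> a)" if "a \<in> BD_alg N" for a c
    using deriv that by (simp add: derivation_def)
  have deriv_comp: "\<delta> (a o\<^sub>L b) = (\<delta> a o\<^sub>L b) + (a o\<^sub>L \<delta> b)" if "a \<in> BD_alg N" "b \<in> BD_alg N" for a b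
    using deriv that by (simp add: derivation_def)
  note comm = bounded_extension_commutator_shift[of \<beta> \<eta> n, OF \<beta>(1) \<eta>]
  \<comment> \<open>The Leibniz rule for I = I I gives \<delta>(I) = 0. Applied to V^(-1) V = I it
    then yields \<delta>(V^(-1)) = - V^(-1) \<delta>(V) V^(-1).\<close>
  have "\<delta> (shift 0) = \<delta> (shift 0) + \<delta> (shift 0)"
  proof -
    have "\<delta> (shift 0 o\<^sub>L shift 0) = (\<delta> (shift 0) o\<^sub>L shift 0) + (shift 0 o\<^sub>L \<delta> (shift 0))"
      by (rule deriv_comp) (rule shift_in_BD_alg)+
    moreover have "A o\<^sub>L shift 0 = A" "shift 0 o\<^sub>L A = A" for A
      by (rule blinfun_eqI, simp add: shift_0)+
    ultimately show ?thesis by metis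
  qed
  then have "\<delta> (shift 0) = 0" by simp
  moreover have "\<delta> (shift (- 1) o\<^sub>L shift 1) =
      (\<delta> (shift (- 1)) o\<^sub>L shift 1) + (shift (- 1) o\<^sub>L \<delta> (shift 1))"
    by (rule deriv_comp) (rule shift_in_BD_alg)+
  ultimately have "(\<delta> (shift (- 1)) o\<^sub>L shift 1) + (shift (- 1) o\<^sub>L \<delta> (shift 1)) = 0"
    by (simp add: shift_add[symmetric])
  then have zero: "\<delta> (shift (- 1)) (shift 1 x) + shift (- 1) (\<delta> (shift 1) x) = 0" for x
    by (metis blinfun.add_left blinfun.zero_left blinfun_apply_blinfun_compose)
  have \<delta>_inv: "\<delta> (shift (- 1)) = cscale_op (- 1) (shift n o\<^sub>L diag_op \<beta> o\<^sub>L shift (- 1))"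
  proof (rule blinfun_eqI)
    fix x
    have "shift 1 (shift (- 1) x) = x" by (rule ell2_eqI) simp
    then have *: "\<delta> (shift (- 1)) x = - shift (- 1) (\<delta> (shift 1) (shift (- 1) x))"
      using zero[of "shift (- 1) x"] by (simp add: eq_neg_iff_add_eq_0)
    show "\<delta> (shift (- 1)) x = cscale_op (- 1) (shift n o\<^sub>L diag_op \<beta> o\<^sub>L shift (- 1)) x"
      unfolding * \<beta>(2) by (rule ell2_eqI) (simp add: \<beta>(1))
  qed
  show ?thesis
    using a
  proof (induction rule: BD_alg_induct)
    case shift
    show ?case using comm(1) \<beta>(2) by simp
  next
    case shift_inv
    show ?case using comm(2) \<delta>_inv by simp
  next
    case (diag A)
    then show ?case by (rule assms(5))
  next
    case (add A B)
    then show ?case using bounded_extension_commutator_add deriv_add by simp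
  next
    case (scale c A)
    then show ?case using bounded_extension_commutator_cscale deriv_scale by simp
  next
    case (comp A B)
    then show ?case using bounded_extension_commutator_compose deriv_comp by simp
  qed
qed

lemma commutator_of_covariant_derivation:
  assumes cov: "covariant_derivation N n \<delta>"
  shows "\<exists>\<eta>. (\<forall>a\<in>BD_alg N. bounded_extension (commutator n \<eta> a) (\<delta> a)) \<and> admissible N n \<eta>"
proof -
  have deriv: "derivation N \<delta>" using cov by (simp add: covariant_derivation_def)
  have BD: "\<delta> a \<in> BD N" if "a \<in> BD_alg N" for a
    using deriv that by (simp add: derivation_def)
  have scale: "\<delta> (cscale_op c a) = cscale_op c (\<delta> a)" if "a \<in> BD_alg N" for a c
    using deriv that by (simp add: derivation_def)
  have comp: "\<delta> (a o\<^sub>L b) = (\<delta> a o\<^sub>L b) + (a o\<^sub>L \<delta> b)" if "a \<in> BD_alg N" "b \<in> BD_alg N" for a b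
    using deriv that by (simp add: derivation_def)
  define \<beta> where "\<beta> = diag_coeff (n + 1) (\<delta> (shift 1))"
  have \<beta>: "bounded (range \<beta>)" "diag_op \<beta> \<in> diag_closure N"
    unfolding \<beta>_def by (rule bounded_diag_coeff, rule diag_coeff_in_diag_closure[OF BD[OF shift_in_BD_alg]])
  have \<delta>_shift: "\<delta> (shift 1) = shift (n + 1) o\<^sub>L diag_op \<beta>"
    unfolding \<beta>_def
    by (rule covariant_derivation_form[OF cov shift_in_BD_alg]) (simp add: rho_shift)
  define \<gamma> where "\<gamma> b = diag_coeff n (\<delta> (diag_op b))" for b
  have \<gamma>_bdd: "bounded (range (\<gamma> b))" for b
    unfolding \<gamma>_def by (rule bounded_diag_coeff)
  have \<delta>_diag: "\<delta> (diag_op b) = shift n o\<^sub>L diag_op (\<gamma> b)"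
    if "diag_op b \<in> diag_alg N" "bounded (range b)" for b
    using covariant_derivation_form[OF cov, of "diag_op b" 0] that diag_alg_subset_BD_alg
    by (auto simp: \<gamma>_def rho_diag_op cscale_op_one)
  \<comment> \<open>The Leibniz rule for two diagonals, read off on the n-th diagonal of the
    matrix.\<close>
  have product: "coord (\<delta> (diag_op b o\<^sub>L diag_op c) (basis_vec l)) (l + n) =
      \<gamma> b l * c l + b (l + n) * \<gamma> c l"
    if "diag_op b \<in> diag_alg N" "bounded (range b)" "diag_op c \<in> diag_alg N" "bounded (range c)"
    for b c l
    using comp[of "diag_op b" "diag_op c"] that diag_alg_subset_BD_alg[of N]
    by (simp add: subset_iff blinfun.add_left \<delta>_diag \<gamma>_bdd coord_basis_vec)
  show ?thesis
  proof (cases "\<exists>j. sn_dvd j N \<and> \<not> int j dvd n")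
    case True
    then obtain j where j: "sn_dvd j N" "\<not> int j dvd n" by blast
    then have "j > 0" by (simp add: sn_dvd_def)
    from periodic_character[OF this j(2)] obtain c :: "int \<Rightarrow> complex" where
      c: "\<And>k l. c (k + l) = c k * c l" "c 0 = 1" "\<And>l. c (l + int j) = c l" "c n \<noteq> 1" by blast
    have c_neq: "c l \<noteq> 0" for l using c(1)[of l "- l"] c(2) by auto
    have c_bdd: "bounded (range c)" using \<open>j > 0\<close> c(3) by (rule bounded_range_periodic)
    have C: "diag_op c \<in> diag_alg N" using j(1) c(3) by (auto simp: diag_alg_def)
    have C_alg: "diag_op c \<in> BD_alg N" using C diag_alg_subset_BD_alg by blast
    \<comment> \<open>This solves \<eta>(l) (c(l) - c(l+n)) = \<gamma>_c(l), using c(l+n) = c(l)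
      c(n); the denominator is nonzero since c(n) \<noteq> 1.\<close>
    define \<eta> where "\<eta> l = \<gamma> c l / (c l * (1 - c n))" for l
    have \<eta>_diag: "\<eta> l * (b l - b (l + n)) = \<gamma> b l"
      if b: "diag_op b \<in> diag_alg N" "bounded (range b)" for b l
    proof -
      \<comment> \<open>Diagonals commute, so both orders of the Leibniz rule agree; this expresses
        \<gamma>_b through \<gamma>_c for every other b.\<close>
      have "diag_op b o\<^sub>L diag_op c = diag_op c o\<^sub>L diag_op b"
        using b(2) c_bdd by (intro blinfun_eqI ell2_eqI) simp
      then have "\<gamma> b l * c l + b (l + n) * \<gamma> c l = \<gamma> c l * b l + c l * c n * \<gamma> b l"
        using product[OF b C c_bdd, of l] product[OF C c_bdd b, of l] by (simp add: c(1))
      then have "\<gamma> c l * (b l - b (l + n)) = \<gamma> b l * (c l * (1 - c n))"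
        by (simp add: algebra_simps)
      then show ?thesis using c(4) c_neq[of l] by (simp add: \<eta>_def)
    qed
    \<comment> \<open>Apply \<delta> to c(L) V = c(1) V c(L) and compare the entries in row l+n+1
      and column l.\<close>
    have intertwine: "\<gamma> c (l + 1) + c (l + n + 1) * \<beta> l = c 1 * (\<beta> l * c l + \<gamma> c l)" for l
    proof -
      have "c 1 * c (k - 1) = c k" for k using c(1)[of 1 "k - 1"] by simp
      then have "diag_op c o\<^sub>L shift 1 = cscale_op (c 1) (shift 1 o\<^sub>L diag_op c)"
        using c_bdd by (intro blinfun_eqI ell2_eqI) (simp add: mult.assoc[symmetric])
      then have "(\<delta> (diag_op c) o\<^sub>L shift 1) + (diag_op c o\<^sub>L \<delta> (shift 1)) =
          cscale_op (c 1) ((\<delta> (shift 1) o\<^sub>L diag_op c) + (shift 1 o\<^sub>L \<delta> (diag_op c)))"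
        using comp[OF C_alg shift_in_BD_alg[of 1]] comp[OF shift_in_BD_alg[of 1] C_alg]
          scale[OF star_subalgebraD(4)[OF star_subalgebra_BD_alg shift_in_BD_alg[of 1] C_alg]]
        by metis
      then have "coord (((\<delta> (diag_op c) o\<^sub>L shift 1) + (diag_op c o\<^sub>L \<delta> (shift 1))) (basis_vec l))
          (l + n + 1) = coord (cscale_op (c 1) ((\<delta> (shift 1) o\<^sub>L diag_op c) +
            (shift 1 o\<^sub>L \<delta> (diag_op c))) (basis_vec l)) (l + n + 1)"
        by simp
      then show ?thesis
        by (simp add: blinfun.add_left \<delta>_diag[OF C c_bdd] \<delta>_shift \<gamma>_bdd \<beta>(1) c_bdd coord_basis_vec)
    qed
    have \<eta>_shift: "\<eta> (l + 1) - \<eta> l = \<beta> l" for l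
    proof -
      \<comment> \<open>A common denominator of \<eta>(l+1) and \<eta>(l), equal to c(l+1) (1 -
        c(n)).\<close>
      define d where "d = c l * c 1 * (1 - c n)"
      have "d \<noteq> 0" using c(4) c_neq by (simp add: d_def)
      have "\<eta> (l + 1) = \<gamma> c (l + 1) / d" by (simp add: \<eta>_def d_def c(1))
      moreover have "\<eta> l = c 1 * \<gamma> c l / d" using c_neq[of 1] by (simp add: \<eta>_def d_def)
      moreover have "\<gamma> c (l + 1) - c 1 * \<gamma> c l = \<beta> l * d"
        using intertwine[of l] by (simp add: d_def c(1) algebra_simps)
      ultimately show ?thesis using \<open>d \<noteq> 0\<close> by (simp add: diff_divide_distrib[symmetric])
    qed
    have "bounded_extension (commutator n \<eta> a) (\<delta> a)" if "a \<in> BD_alg N" for a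
    proof (rule derivation_eq_commutator[OF deriv \<beta>(1) \<delta>_shift \<eta>_shift _ that])
      fix a
      assume a: "a \<in> diag_alg N"
      then obtain b where b: "a = diag_op b" "bounded (range b)" by (rule bounded_diag_algE) blast
      then show "bounded_extension (commutator n \<eta> a) (\<delta> a)"
        using a \<delta>_diag \<eta>_diag bounded_extension_commutator_diag_op[OF b(2) \<gamma>_bdd] by simp
    qed
    moreover have "in_diag_closure N \<eta>"
    proof -
      \<comment> \<open>The inverse character: it removes the factor c(l) from \<gamma>_c(l), which
        exhibits \<eta> as the n-th diagonal of the element A of \<open>BD N\<close>.\<close>
      define c' where "c' l = c (- l)" for l
      have cc': "c' l = inverse (c l)" for l
        using c(1)[of l "- l"] c(2) by (simp add: c'_def field_simps c_neq)
      have "c' (l + int j) = c' l" for l by (simp add: cc' c(3))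
      then have C': "diag_op c' \<in> diag_alg N" "bounded (range c')"
        using j(1) \<open>j > 0\<close> by (auto simp: diag_alg_def intro: bounded_range_periodic)
      define A where "A = cscale_op (inverse (1 - c n)) (\<delta> (diag_op c) o\<^sub>L diag_op c')"
      have "A \<in> BD N"
        unfolding A_def using BD[OF C_alg] C'(1) diag_alg_subset_BD[of N]
        by (intro star_subalgebraD(3,4)[OF star_subalgebra_BD]) auto
      moreover have "diag_coeff n A = \<eta>"
        by (rule ext, simp add: diag_coeff_def A_def \<delta>_diag[OF C c_bdd] \<gamma>_bdd C'(2) coord_basis_vec)
          (simp add: \<eta>_def cc' divide_inverse mult_ac)
      ultimately show ?thesis
        unfolding in_diag_closure_iff using bounded_diag_coeff diag_coeff_in_diag_closure by metis
    qed
    ultimately show ?thesis using True unfolding admissible_iff by auto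
  next
    case False
    obtain \<eta> where \<eta>: "\<And>l. \<eta> (l + 1) - \<eta> l = \<beta> l" using telescoping_primitive[of \<beta>] by blast
    have diag: "bounded_extension (commutator n \<eta> a) (\<delta> a)" if a: "a \<in> diag_alg N" for a
    proof -
      obtain b j where b: "a = diag_op b" "bounded (range b)" "sn_dvd j N" "\<And>l. b (l + int j) = b l"
        using a by (rule bounded_diag_algE) blast
      have jn: "int j dvd n" using False b(3) by blast
      have j: "j > 0" using b(3) by (simp add: sn_dvd_def)
      have b_n: "b (l + n) = b l" for l using periodic_dvd[of b, OF b(4) jn] .
      have "\<gamma> b l = 0" for l
      proof -
        \<comment> \<open>The indicator of the residue class of l modulo j gives a periodic
          projection on whose support b has the constant value b(l).\<close>
        define e :: "int \<Rightarrow> complex" where "e k = (if int j dvd k - l then 1 else 0)" for k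
        have e_j: "e (k + int j) = e k" for k
          unfolding e_def using dvd_add_left_iff[of "int j" "int j" "k - l"]
          by (simp add: algebra_simps)
        have e: "diag_op e \<in> diag_alg N" "bounded (range e)"
          using b(3) j e_j by (auto simp: diag_alg_def intro: bounded_range_periodic)
        have e_l: "e l = 1" "e (l + n) = 1" using jn by (simp_all add: e_def)
        have ee: "diag_op e o\<^sub>L diag_op e = diag_op e"
          using e(2) by (intro blinfun_eqI ell2_eqI) (simp add: e_def)
        have "coord (\<delta> (diag_op e) (basis_vec l)) (l + n) = \<gamma> e l"
          by (simp add: \<gamma>_def diag_coeff_def)
        \<comment> \<open>As e(l) = e(l+n) = 1, the Leibniz rule for the idempotent reads
          \<gamma>_e(l) = 2 \<gamma>_e(l).\<close>
        then have \<gamma>_e: "\<gamma> e l = 0" using product[OF e e, of l] ee e_l by simp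
        have "b k * e k = b l * e k" for k
          using periodic_dvd[of b "int j" "k - l" l, OF b(4)] by (simp add: e_def)
        then have be: "diag_op b o\<^sub>L diag_op e = cscale_op (b l) (diag_op e)"
          using b(2) e(2) by (intro blinfun_eqI ell2_eqI) (simp add: mult.assoc[symmetric])
        \<comment> \<open>Differentiating b(L) e(L) = b(l) e(L) in two ways leaves only the term
          \<gamma>_b(l), because \<gamma>_e(l) = 0.\<close>
        have "\<gamma> b l * e l + b (l + n) * \<gamma> e l = coord (\<delta> (cscale_op (b l) (diag_op e)) (basis_vec l)) (l + n)"
          using product[OF _ b(2) e, of l] a b(1) be by simp
        also have "\<dots> = b l * \<gamma> e l"
          using scale[of "diag_op e"] e(1) diag_alg_subset_BD_alg[of N]
          by (auto simp: \<gamma>_def diag_coeff_def)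
        finally show ?thesis using \<gamma>_e e_l by simp
      qed
      then have "\<eta> l * (b l - b (l + n)) = \<gamma> b l" for l by (simp add: b_n)
      then show ?thesis
        using bounded_extension_commutator_diag_op[OF b(2) \<gamma>_bdd, of \<eta> n b] \<delta>_diag a b(1,2) by simp
    qed
    have "bounded_extension (commutator n \<eta> a) (\<delta> a)" if "a \<in> BD_alg N" for a
      using derivation_eq_commutator[OF deriv \<beta>(1) \<delta>_shift \<eta> diag that] .
    moreover have "in_diag_closure N (\<lambda>l. \<eta> (l + 1) - \<eta> l)"
      unfolding \<eta> in_diag_closure_iff using \<beta> by simp
    ultimately show ?thesis using False unfolding admissible_iff by auto
  qed
qed

theorem theorem3p5:
  fixes N :: supernatural and n :: int
  shows
    "(\<forall>\<delta>. covariant_derivation N n \<delta> \<longrightarrow>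
        (\<exists>\<eta>. (\<forall>a\<in>BD_alg N. bounded_extension (commutator n \<eta> a) (\<delta> a)) \<and>
             admissible N n \<eta>)) \<and>
     (\<forall>\<eta>. admissible N n \<eta> \<longrightarrow>
        (\<forall>a\<in>BD_alg N. \<exists>!D. bounded_extension (commutator n \<eta> a) D) \<and>
        (\<forall>\<delta>. (\<forall>a\<in>BD_alg N. bounded_extension (commutator n \<eta> a) (\<delta> a)) \<longrightarrow>
             covariant_derivation N n \<delta>))"
proof (intro conjI allI impI ballI)
  fix \<eta> a
  assume "admissible N n \<eta>" "a \<in> BD_alg N"
  then show "\<exists>!D. bounded_extension (commutator n \<eta> a) D"
    using commutator_bounded_extension_ex bounded_extension_unique by blast
qed (auto intro: commutator_of_covariant_derivation covariant_derivation_of_commutator)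

end
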